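(* Let $d=2$, let $k\ge1$ and $0\le s\le k-1$ be integers, and let $u_k^{cg}\in CG_{0,\Gamma_D}(\mathcal T_h,k)$ satisfy $(A\nabla u_k^{cg},\nabla v)_\Omega=(f,v)_\Omega-\langle g,v\rangle_{\Gamma_N}$ for all $v\in CG_{0,\Gamma_D}(\mathcal T_h,k)$. Let $r(v)=(f-\nabla\cdot\tilde{\boldsymbol\sigma}_{k-1}(u_k^{cg}),v)_\Omega$. For each $z\in\mathcal N$ let $\boldsymbol\sigma_z^\Delta\in\mathring{RT}_{0,\partial\omega_z}(\omega_z,s)$ be a solution (a specific one, when the solution is not unique) of $$\mathcal A_z(\boldsymbol\sigma_z^\Delta,v):=\sum_{F\in\mathcal E_z\setminus\mathcal E_N}\int_F\boldsymbol\sigma_z^\Delta\cdot\mathbf n_F\,[\![v]\!]\,ds=r(v\lambda_z)\qquad\forall v\in DG(\omega_z,s).$$ Let $\mathcal N^*$ be the set of interior vertices and of boundary vertices shared by two Dirichlet boundary edges. When the solution is not unique, i.e. for $z\in\mathcal N^*$, let $\boldsymbol\sigma_z^{\#}\in\mathring{RT}_{0,\partial\omega_z}(\omega_z,s)$ be a nontrivial solution of $$\mathcal A_z(\boldsymbol\sigma_z^{\#},v)=0\quad\forall v\in DG(\omega_z,s),\qquad\|A^{-1/2}\boldsymbol\sigma_z^{\#}\|_{\omega_z}=1,$$ and let $\boldsymbol\sigma_z^{\Delta,*}$ be the function $\boldsymbol\sigma_z^\Delta-\lambda\boldsymbol\sigma_z^{\#}$ that minimizes $\|A^{-1/2}(\boldsymbol\sigma_z^\Delta-\lambda\boldsymbol\sigma_z^{\#})\|_{\omega_z}$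 over $\lambda\in\mathbb R$. Then $$\sum_{F\in\mathcal E\setminus\mathcal E_N}\int_F\boldsymbol\sigma_s^{\Delta,*}\cdot\mathbf n_F\,[\![v]\!]\,ds=r(v)\qquad\forall v\in DG(\mathcal T_h,s),$$ where $$\boldsymbol\sigma_s^{\Delta,*}=\sum_{z\in\mathcal N^*}\boldsymbol\sigma_z^{\Delta,*}+\sum_{z\in\mathcal N\setminus\mathcal N^*}\boldsymbol\sigma_z^\Delta=\sum_{z\in\mathcal N^*}(\boldsymbol\sigma_z^\Delta-c_z\boldsymbol\sigma_z^{\#})+\sum_{z\in\mathcal N\setminus\mathcal N^*}\boldsymbol\sigma_z^\Delta,\qquad c_z=(A^{-1}\boldsymbol\sigma_z^\Delta,\boldsymbol\sigma_z^{\#})_{\omega_z}.$$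
   Context: Domain and mesh: $\Omega\subset\mathbb R^2$ is a bounded polygonal domain with Lipschitz boundary $\partial\Omega=\overline\Gamma_D\cup\overline\Gamma_N$, $\Gamma_D\cap\Gamma_N=\emptyset$, $\mathrm{meas}_1(\Gamma_D)\ne0$. $\mathcal T_h$ is a regular triangulation of $\Omega$, $\mathcal N$ its set of vertices. $\mathcal E=\mathcal E_I\cup\mathcal E_D\cup\mathcal E_N$ is the set of edges: interior ones, those on $\Gamma_D$ (Dirichlet edges), those on $\Gamma_N$. $\mathbf n_F$ is a fixed unit normal of $F$. For $F\in\mathcal E_I$, $K_F^-,K_F^+$ are the two elements sharing $F$, with $\mathbf n_F$ outward to $K_F^-$; for boundary $F$, $\mathbf n_F$ is outward to $\Omega$ and $K_F^-$ is the element containing $F$. $v_F^\pm$ are the traces from $K_F^\pm$. For $z\in\mathcal N$: $\omega_z$ is the union of elements having $z$ as a vertex, $\mathcal E_z$ the set of edges containing $z$, $\lambda_z$ the continuous piecewise linear barycentric basis function at $z$. $(\cdot,\cdot)_{\omega_z}$, $\|\cdot\|_{\omega_z}$ are the $L^2(\omega_z)$ inner product and norm. Data: $A$ is a symmetric positive definite tensor, constant on each $K\in\mathcal T_h$; $f\in L^2(\Omega)$; $g|_F\in\mathbb P_{k-1}(F)$ for $F\in\mathcal E_N$. Jumps and averages: $[\![v]\!]_F=v_F^--v_F^+$ on $F\in\mathcal E_I$, $[\![v]\!]_F=v_F^-$ on boundary edges. $\alpha_F^\pm$ is the maximal eigenvalue of $A|_{K_F^\pm}$, $w_F^\pm=\alpha_F^\mp/(\alpha_F^-+\alpha_F^+)$,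 $\{v\}_w^F=w_F^+v_F^++w_F^-v_F^-$ on $\mathcal E_I$ and $\{v\}_w^F=v$ on boundary edges. Spaces: $DG(\mathcal T_h,m)=\{v\in L^2(\Omega):v|_K\in\mathbb P_m(K)\ \forall K\}$; $DG(\omega_z,m)$ is its analogue on the patch $\omega_z$, extended by zero; $CG_{0,\Gamma_D}(\mathcal T_h,k)=\{v\in H^1(\Omega):v|_K\in\mathbb P_k(K)\ \forall K,\ v=0\text{ on }\Gamma_D\}$; $RT(\mathcal T_h,m)=\{\boldsymbol\tau\in H(\mathrm{div};\Omega):\boldsymbol\tau|_K\in\mathbb P_m(K)^2+\mathbf x\,\mathbb P_m(K)\ \forall K\}$. For $m\ge1$, $\mathring{RT}(\mathcal T_h,m)$ is the set of $\boldsymbol\tau\in RT(\mathcal T_h,m)$ with $(\boldsymbol\tau,\boldsymbol\psi)_K=0$ for all $\boldsymbol\psi\in\mathbb P_{m-1}(K)^2$, $K\in\mathcal T_h$, and $\boldsymbol\tau\cdot\mathbf n_F=0$ for $F\in\mathcal E_N$; for $m=0$, $\mathring{RT}(\mathcal T_h,0)=RT(\mathcal T_h,0)$. $\mathring{RT}(\omega_z,m)$ is the analogous space on the patch $\omega_z$, and $\mathring{RT}_{0,\partial\omega_z}(\omega_z,m)$ is the set of $\boldsymbol\tau\in\mathring{RT}(\omega_z,m)$ with $\boldsymbol\tau\cdot\mathbf n_F=0$ on all edges $F\subset\partial\omega_z$, except edges in $\mathcal E_D$ containing $z$, where no condition is imposed; such functions are extended by zero outside $\omega_z$. Weighted averaging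 flux: for $u_h\in DG(\mathcal T_h,k)$ and $0\le m\le k$, $\tilde{\boldsymbol\sigma}_m(u_h)\in RT(\mathcal T_h,m)$ is determined by $\int_F\tilde{\boldsymbol\sigma}_m(u_h)\cdot\mathbf n_F\phi\,ds=-\int_F\{A\nabla u_h\cdot\mathbf n_F\}_w^F\phi\,ds$ for $F\in\mathcal E\setminus\mathcal E_N$ and $=\int_Fg\phi\,ds$ for $F\in\mathcal E_N$, for all $\phi\in\mathbb P_m(F)$, and, if $m\ge1$, $(\tilde{\boldsymbol\sigma}_m(u_h),\boldsymbol\psi)_K=-(A\nabla u_h,\boldsymbol\psi)_K$ for all $\boldsymbol\psi\in\mathbb P_{m-1}(K)^2$, $K\in\mathcal T_h$. *)

theory Defs
  imports "HOL-Analysis.Analysis"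
begin

section \<open>Lebesgue and Sobolev spaces\<close>

text \<open>
  Members of function spaces are represented by functions on the whole plane. Values on null sets
  are irrelevant, which is why the completed measure \<open>lebesgue\<close> is used. The notions below serve
  scalar and vector fields alike; on the reals, \<open>\<bullet>\<close> is multiplication.
\<close>

definition L2 :: "(real^2) set \<Rightarrow> (real^2 \<Rightarrow> 'b::euclidean_space) \<Rightarrow> bool" where
  "L2 U v \<longleftrightarrow> v \<in> borel_measurable (lebesgue_on U) \<and>
     integrable (lebesgue_on U) (\<lambda>x. (norm (v x))\<^sup>2)"

definition L2_inner :: "(real^2) set \<Rightarrow> (real^2 \<Rightarrow> 'b::euclidean_space) \<Rightarrow> (real^2 \<Rightarrow> 'b) \<Rightarrow> real" where
  "L2_inner U v w = integral\<^sup>L (lebesgue_on U) (\<lambda>x. v x \<bullet> w x)"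

definition L2_norm :: "(real^2) set \<Rightarrow> (real^2 \<Rightarrow> 'b::euclidean_space) \<Rightarrow> real" where
  "L2_norm U v = sqrt (L2_inner U v v)"

definition grad :: "(real^2 \<Rightarrow> real) \<Rightarrow> real^2 \<Rightarrow> real^2" where
  "grad v x = (THE D. GDERIV v x :> D)"

text \<open>
  Smoothness: \<open>D i j\<close> is the mixed partial derivative of order \<open>(i, j)\<close>. All of them are required to
  exist and to be totally differentiable (hence continuous).
\<close>

definition smooth_plane :: "(real^2 \<Rightarrow> real) \<Rightarrow> bool" where
  "smooth_plane \<phi> \<longleftrightarrow>
     (\<exists>D :: nat \<Rightarrow> nat \<Rightarrow> real^2 \<Rightarrow> real. D 0 0 = \<phi> \<and>
        (\<forall>i j x. (D i j has_derivative (\<lambda>h. D (Suc i) j x * h $ 1 + D i (Suc j) x * h $ 2)) (at x)))"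

definition test_function :: "(real^2) set \<Rightarrow> (real^2 \<Rightarrow> real) \<Rightarrow> bool" where
  "test_function U \<phi> \<longleftrightarrow> smooth_plane \<phi> \<and>
     compact (closure {x. \<phi> x \<noteq> 0}) \<and> closure {x. \<phi> x \<noteq> 0} \<subseteq> U"

definition has_weak_grad :: "(real^2) set \<Rightarrow> (real^2 \<Rightarrow> real) \<Rightarrow> (real^2 \<Rightarrow> real^2) \<Rightarrow> bool" where
  "has_weak_grad U v G \<longleftrightarrow> L2 U G \<and>
     (\<forall>\<phi>. test_function U \<phi> \<longrightarrow>
        integral\<^sup>L (lebesgue_on U) (\<lambda>x. v x *\<^sub>R grad \<phi> x) =
        - integral\<^sup>L (lebesgue_on U) (\<lambda>x. \<phi> x *\<^sub>R G x))"

definition H1 :: "(real^2) set \<Rightarrow> (real^2 \<Rightarrow> real) \<Rightarrow> bool" where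
  "H1 U v \<longleftrightarrow> L2 U v \<and> (\<exists>G. has_weak_grad U v G)"

text \<open>Weak gradients and weak divergences are unique up to null sets.\<close>

definition weak_grad :: "(real^2) set \<Rightarrow> (real^2 \<Rightarrow> real) \<Rightarrow> real^2 \<Rightarrow> real^2" where
  "weak_grad U v = (SOME G. has_weak_grad U v G)"

definition has_weak_div :: "(real^2) set \<Rightarrow> (real^2 \<Rightarrow> real^2) \<Rightarrow> (real^2 \<Rightarrow> real) \<Rightarrow> bool" where
  "has_weak_div U \<tau> d \<longleftrightarrow> L2 U d \<and>
     (\<forall>\<phi>. test_function U \<phi> \<longrightarrow> L2_inner U \<tau> (grad \<phi>) = - L2_inner U d \<phi>)"

definition Hdiv :: "(real^2) set \<Rightarrow> (real^2 \<Rightarrow> real^2) \<Rightarrow> bool" where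
  "Hdiv U \<tau> \<longleftrightarrow> L2 U \<tau> \<and> (\<exists>d. has_weak_div U \<tau> d)"

definition weak_div :: "(real^2) set \<Rightarrow> (real^2 \<Rightarrow> real^2) \<Rightarrow> real^2 \<Rightarrow> real" where
  "weak_div U \<tau> = (SOME d. has_weak_div U \<tau> d)"


section \<open>Domain, boundary parts and triangulation\<close>

definition polygonal_domain :: "(real^2) set \<Rightarrow> bool" where
  "polygonal_domain U \<longleftrightarrow> open U \<and> connected U \<and> bounded U \<and> U \<noteq> {} \<and>
     (\<exists>S. finite S \<and> frontier U = (\<Union>(a, b)\<in>S. closed_segment a b))"

text \<open>
  Near every boundary point, in suitable orthonormal coordinates, the set is the strict hypograph
  of a Lipschitz function (so that its boundary is locally the graph of that function).
\<close>

definition lipschitz_boundary :: "(real^2) set \<Rightarrow> bool" where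
  "lipschitz_boundary U \<longleftrightarrow>
     (\<forall>x\<in>frontier U. \<exists>e1 e2 a b \<gamma> L. norm e1 = 1 \<and> norm e2 = 1 \<and> e1 \<bullet> e2 = 0 \<and>
        0 < a \<and> 0 < b \<and> L-lipschitz_on UNIV \<gamma> \<and>
        (\<forall>s t :: real. \<bar>s\<bar> < a \<longrightarrow> \<bar>t\<bar> < b \<longrightarrow>
           (x + s *\<^sub>R e1 + t *\<^sub>R e2 \<in> U \<longleftrightarrow> t < \<gamma> s)))"

text \<open>One-dimensional Hausdorff (outer) measure.\<close>

definition meas1 :: "(real^2) set \<Rightarrow> ennreal" where
  "meas1 S = (SUP \<delta>\<in>{0::real<..}.
     INF U\<in>{U :: nat \<Rightarrow> (real^2) set. (\<forall>i. bounded (U i) \<and> diameter (U i) \<le> \<delta>) \<and> S \<subseteq> (\<Union>i. U i)}.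
       \<Sum>i. ennreal (diameter (U i)))"

text \<open>
  \<open>Dom\<close> is the domain, \<open>GD\<close> and \<open>GN\<close> are the Dirichlet and Neumann parts of its boundary, \<open>Th\<close> is
  the set of (closed) triangles, \<open>nrm F\<close> is the fixed unit normal of the edge \<open>F\<close>, and \<open>Km F\<close>,
  \<open>Kp F\<close> are the elements on its minus and plus sides (\<open>Kp F\<close> is meaningful for interior edges only).
\<close>

record fe_mesh =
  Dom :: "(real^2) set"
  GD :: "(real^2) set"
  GN :: "(real^2) set"
  Th :: "(real^2) set set"
  nrm :: "(real^2) set \<Rightarrow> real^2"
  Km :: "(real^2) set \<Rightarrow> (real^2) set"
  Kp :: "(real^2) set \<Rightarrow> (real^2) set"

definition vertices :: "fe_mesh \<Rightarrow> (real^2) set" where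
  "vertices M = {z. \<exists>K\<in>Th M. z extreme_point_of K}"

definition edges :: "fe_mesh \<Rightarrow> (real^2) set set" where
  "edges M = {F. \<exists>K\<in>Th M. F facet_of K}"

definition bdry_edges :: "fe_mesh \<Rightarrow> (real^2) set set" where
  "bdry_edges M = {F \<in> edges M. F \<subseteq> frontier (Dom M)}"

definition int_edges :: "fe_mesh \<Rightarrow> (real^2) set set" where
  "int_edges M = edges M - bdry_edges M"

definition D_edges :: "fe_mesh \<Rightarrow> (real^2) set set" where
  "D_edges M = {F \<in> bdry_edges M. F \<subseteq> closure (GD M)}"

definition N_edges :: "fe_mesh \<Rightarrow> (real^2) set set" where
  "N_edges M = {F \<in> bdry_edges M. F \<subseteq> closure (GN M)}"

definition edges_at :: "fe_mesh \<Rightarrow> real^2 \<Rightarrow> (real^2) set set" where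
  "edges_at M z = {F \<in> edges M. z \<in> F}"

definition patch :: "fe_mesh \<Rightarrow> real^2 \<Rightarrow> (real^2) set set" where
  "patch M z = {K \<in> Th M. z extreme_point_of K}"

definition omega :: "fe_mesh \<Rightarrow> real^2 \<Rightarrow> (real^2) set" where
  "omega M z = \<Union>(patch M z)"

definition boundary_split :: "fe_mesh \<Rightarrow> bool" where
  "boundary_split M \<longleftrightarrow> frontier (Dom M) = closure (GD M) \<union> closure (GN M) \<and>
     GD M \<inter> GN M = {} \<and> meas1 (GD M) \<noteq> 0"

text \<open>
  The last two conjuncts say that the triangulation resolves the boundary partition: every boundary
  edge belongs to exactly one of the two parts.
\<close>

definition regular_triangulation :: "fe_mesh \<Rightarrow> bool" where
  "regular_triangulation M \<longleftrightarrow> triangulation (Th M) \<and> (\<forall>K\<in>Th M. 2 simplex K) \<and>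
     \<Union>(Th M) = closure (Dom M) \<and>
     bdry_edges M = D_edges M \<union> N_edges M \<and> D_edges M \<inter> N_edges M = {}"

text \<open>
  Since a triangle lies on one side of the line through each of its edges, the following inequality
  forces \<open>\<nu>\<close> to be orthogonal to \<open>F\<close> and to point out of \<open>K\<close>.
\<close>

definition outer_unit_normal :: "(real^2) set \<Rightarrow> (real^2) set \<Rightarrow> real^2 \<Rightarrow> bool" where
  "outer_unit_normal K F \<nu> \<longleftrightarrow> norm \<nu> = 1 \<and> (\<forall>x\<in>F. \<forall>y\<in>K. \<nu> \<bullet> (y - x) \<le> 0)"

definition edge_orientation :: "fe_mesh \<Rightarrow> bool" where
  "edge_orientation M \<longleftrightarrow>
     (\<forall>F\<in>edges M. Km M F \<in> Th M \<and> F facet_of Km M F \<and> outer_unit_normal (Km M F) F (nrm M F)) \<and>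
     (\<forall>F\<in>int_edges M. Kp M F \<in> Th M \<and> F facet_of Kp M F \<and> Kp M F \<noteq> Km M F)"

definition admissible_mesh :: "fe_mesh \<Rightarrow> bool" where
  "admissible_mesh M \<longleftrightarrow> polygonal_domain (Dom M) \<and> lipschitz_boundary (Dom M) \<and>
     boundary_split M \<and> regular_triangulation M \<and> edge_orientation M"

text \<open>Interior vertices, and boundary vertices shared by two Dirichlet edges.\<close>

definition vertices_star :: "fe_mesh \<Rightarrow> (real^2) set" where
  "vertices_star M = {z \<in> vertices M. z \<in> Dom M \<or>
     (z \<in> frontier (Dom M) \<and> (\<exists>F\<in>D_edges M. \<exists>F'\<in>D_edges M. F \<noteq> F' \<and> z \<in> F \<and> z \<in> F'))}"

definition hat_function :: "fe_mesh \<Rightarrow> real^2 \<Rightarrow> (real^2 \<Rightarrow> real) \<Rightarrow> bool" where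
  "hat_function M z l \<longleftrightarrow> continuous_on (closure (Dom M)) l \<and>
     (\<forall>K\<in>Th M. \<exists>a b. \<forall>x\<in>K. l x = a + b \<bullet> x) \<and>
     (\<forall>z'\<in>vertices M. l z' = (if z' = z then 1 else 0))"


section \<open>Piecewise polynomial spaces\<close>

definition Pol :: "nat \<Rightarrow> (real^2 \<Rightarrow> real) set" where
  "Pol m = {p. \<exists>c :: nat \<Rightarrow> nat \<Rightarrow> real. \<forall>x. p x = (\<Sum>i\<le>m. \<Sum>j\<le>m - i. c i j * (x $ 1) ^ i * (x $ 2) ^ j)}"

definition Pol_vec :: "nat \<Rightarrow> (real^2 \<Rightarrow> real^2) set" where
  "Pol_vec m = {p. \<forall>i. (\<lambda>x. p x $ i) \<in> Pol m}"

text \<open>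
  Trace from \<open>K\<close> at a point of its boundary. Members of the piecewise polynomial spaces are
  represented by functions that coincide with polynomials at every point of the interior of each
  element (and are arbitrary on the edges), so that these limits exist and depend only on the
  \<open>L2\<close> class.
\<close>

definition tr :: "(real^2) set \<Rightarrow> (real^2 \<Rightarrow> 'b::t2_space) \<Rightarrow> real^2 \<Rightarrow> 'b" where
  "tr K v x = Lim (at x within interior K) v"

definition DG_on :: "(real^2) set \<Rightarrow> (real^2) set set \<Rightarrow> nat \<Rightarrow> (real^2 \<Rightarrow> real) set" where
  "DG_on U P m = {v. L2 U v \<and> (\<forall>K\<in>P. \<exists>p\<in>Pol m. \<forall>x\<in>interior K. v x = p x)}"

definition DG :: "fe_mesh \<Rightarrow> nat \<Rightarrow> (real^2 \<Rightarrow> real) set" where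
  "DG M m = DG_on (Dom M) (Th M) m"

definition DG_patch :: "fe_mesh \<Rightarrow> real^2 \<Rightarrow> nat \<Rightarrow> (real^2 \<Rightarrow> real) set" where
  "DG_patch M z m = {v \<in> DG_on (interior (omega M z)) (patch M z) m. \<forall>x. x \<notin> omega M z \<longrightarrow> v x = 0}"

definition CG0 :: "fe_mesh \<Rightarrow> nat \<Rightarrow> (real^2 \<Rightarrow> real) set" where
  "CG0 M k = {v. H1 (Dom M) v \<and> (\<forall>K\<in>Th M. \<exists>p\<in>Pol k. \<forall>x\<in>interior K. v x = p x) \<and>
     (\<forall>F\<in>D_edges M. \<forall>x\<in>F. tr (Km M F) v x = 0)}"

definition RT_on :: "(real^2) set \<Rightarrow> (real^2) set set \<Rightarrow> nat \<Rightarrow> (real^2 \<Rightarrow> real^2) set" where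
  "RT_on U P m = {\<tau>. Hdiv U \<tau> \<and>
     (\<forall>K\<in>P. \<exists>p\<in>Pol_vec m. \<exists>q\<in>Pol m. \<forall>x\<in>interior K. \<tau> x = p x + q x *\<^sub>R x)}"

definition RT :: "fe_mesh \<Rightarrow> nat \<Rightarrow> (real^2 \<Rightarrow> real^2) set" where
  "RT M m = RT_on (Dom M) (Th M) m"

definition RT_ring_patch :: "fe_mesh \<Rightarrow> real^2 \<Rightarrow> nat \<Rightarrow> (real^2 \<Rightarrow> real^2) set" where
  "RT_ring_patch M z m = {\<tau> \<in> RT_on (interior (omega M z)) (patch M z) m. 1 \<le> m \<longrightarrow>
     (\<forall>K\<in>patch M z. \<forall>\<psi>\<in>Pol_vec (m - 1). L2_inner K \<tau> \<psi> = 0) \<and>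
     (\<forall>F\<in>N_edges M. \<forall>K\<in>patch M z. F facet_of K \<longrightarrow> (\<forall>x\<in>F. tr K \<tau> x \<bullet> nrm M F = 0))}"

text \<open>
  Normal components on the boundary of the patch are taken from inside the patch; no condition is
  imposed on Dirichlet edges containing \<open>z\<close>.
\<close>

definition RT_ring_patch0 :: "fe_mesh \<Rightarrow> real^2 \<Rightarrow> nat \<Rightarrow> (real^2 \<Rightarrow> real^2) set" where
  "RT_ring_patch0 M z m = {\<tau> \<in> RT_ring_patch M z m.
     (\<forall>F\<in>edges M. F \<subseteq> frontier (omega M z) \<and> \<not> (F \<in> D_edges M \<and> z \<in> F) \<longrightarrow>
        (\<forall>K\<in>patch M z. F facet_of K \<longrightarrow> (\<forall>x\<in>F. tr K \<tau> x \<bullet> nrm M F = 0))) \<and>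
     (\<forall>x. x \<notin> omega M z \<longrightarrow> \<tau> x = 0)}"


section \<open>Edge terms\<close>

text \<open>Arc length integral over a segment; it does not depend on the chosen order of the endpoints.\<close>

definition edge_integral :: "(real^2) set \<Rightarrow> (real^2 \<Rightarrow> real) \<Rightarrow> real" where
  "edge_integral F \<phi> = (let (a, b) = (SOME ab. F = closed_segment (fst ab) (snd ab)) in
     dist a b * integral\<^sup>L (lebesgue_on {0..1}) (\<lambda>t. \<phi> (a + t *\<^sub>R (b - a))))"

definition jump :: "fe_mesh \<Rightarrow> (real^2) set \<Rightarrow> (real^2 \<Rightarrow> real) \<Rightarrow> real^2 \<Rightarrow> real" where
  "jump M F v x = (if F \<in> int_edges M then tr (Km M F) v x - tr (Kp M F) v x else tr (Km M F) v x)"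

text \<open>
  For fields in \<open>H(div)\<close> the normal component is single valued on interior edges, so the minus side
  may be used.
\<close>

definition normal_tr :: "fe_mesh \<Rightarrow> (real^2) set \<Rightarrow> (real^2 \<Rightarrow> real^2) \<Rightarrow> real^2 \<Rightarrow> real" where
  "normal_tr M F \<tau> x = tr (Km M F) \<tau> x \<bullet> nrm M F"

definition jump_form ::
  "fe_mesh \<Rightarrow> (real^2) set set \<Rightarrow> (real^2 \<Rightarrow> real^2) \<Rightarrow> (real^2 \<Rightarrow> real) \<Rightarrow> real" where
  "jump_form M Es \<tau> v = (\<Sum>F\<in>Es. edge_integral F (\<lambda>x. normal_tr M F \<tau> x * jump M F v x))"

definition local_form :: "fe_mesh \<Rightarrow> real^2 \<Rightarrow> (real^2 \<Rightarrow> real^2) \<Rightarrow> (real^2 \<Rightarrow> real) \<Rightarrow> real" where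
  "local_form M z \<tau> v = jump_form M (edges_at M z - N_edges M) \<tau> v"


section \<open>Data, discrete solution and weighted averaging flux\<close>

definition spd :: "real^2^2 \<Rightarrow> bool" where
  "spd B \<longleftrightarrow> transpose B = B \<and> (\<forall>\<xi>. \<xi> \<noteq> 0 \<longrightarrow> 0 < \<xi> \<bullet> (B *v \<xi>))"

definition pw_const_spd :: "fe_mesh \<Rightarrow> (real^2 \<Rightarrow> real^2^2) \<Rightarrow> bool" where
  "pw_const_spd M A \<longleftrightarrow> (\<forall>K\<in>Th M. \<exists>B. spd B \<and> (\<forall>x\<in>interior K. A x = B))"

definition value_on :: "(real^2) set \<Rightarrow> (real^2 \<Rightarrow> real^2^2) \<Rightarrow> real^2^2" where
  "value_on K A = (THE B. \<forall>x\<in>interior K. A x = B)"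

definition max_eigenvalue :: "real^2^2 \<Rightarrow> real" where
  "max_eigenvalue B = Max {\<mu>. \<exists>\<xi>. \<xi> \<noteq> 0 \<and> B *v \<xi> = \<mu> *\<^sub>R \<xi>}"

text \<open>The symmetric positive definite square root of the inverse.\<close>

definition inv_sqrt :: "real^2^2 \<Rightarrow> real^2^2" where
  "inv_sqrt B = (SOME S. spd S \<and> S ** S = matrix_inv B)"

text \<open>The relative interior occurs because \<open>g\<close> need not be continuous at the vertices.\<close>

definition neumann_data :: "fe_mesh \<Rightarrow> nat \<Rightarrow> (real^2 \<Rightarrow> real) \<Rightarrow> bool" where
  "neumann_data M m g \<longleftrightarrow> (\<forall>F\<in>N_edges M. \<exists>p\<in>Pol m. \<forall>x\<in>rel_interior F. g x = p x)"

definition weighted_average ::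
  "fe_mesh \<Rightarrow> (real^2 \<Rightarrow> real^2^2) \<Rightarrow> (real^2) set \<Rightarrow> (real^2 \<Rightarrow> real) \<Rightarrow> real^2 \<Rightarrow> real" where
  "weighted_average M A F v x =
     (if F \<in> int_edges M then
        let am = max_eigenvalue (value_on (Km M F) A); ap = max_eigenvalue (value_on (Kp M F) A);
            wm = ap / (am + ap); wp = am / (am + ap)
        in wp * tr (Kp M F) v x + wm * tr (Km M F) v x
      else tr (Km M F) v x)"

definition cg_solution ::
  "fe_mesh \<Rightarrow> (real^2 \<Rightarrow> real^2^2) \<Rightarrow> (real^2 \<Rightarrow> real) \<Rightarrow> (real^2 \<Rightarrow> real) \<Rightarrow> nat \<Rightarrow> (real^2 \<Rightarrow> real) \<Rightarrow> bool" where
  "cg_solution M A f g k u \<longleftrightarrow> u \<in> CG0 M k \<and>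
     (\<forall>v\<in>CG0 M k.
        L2_inner (Dom M) (\<lambda>x. A x *v weak_grad (Dom M) u x) (weak_grad (Dom M) v) =
        L2_inner (Dom M) f v - (\<Sum>F\<in>N_edges M. edge_integral F (\<lambda>x. g x * tr (Km M F) v x)))"

text \<open>
  \<open>\<sigma>\<close> is the weighted averaging flux of order \<open>m\<close> of \<open>u\<close>. Here \<open>grad u\<close> is the elementwise gradient,
  as \<open>u\<close> is only assumed to be piecewise polynomial; its values on the edges do not matter.
\<close>

definition averaging_flux ::
  "fe_mesh \<Rightarrow> (real^2 \<Rightarrow> real^2^2) \<Rightarrow> (real^2 \<Rightarrow> real) \<Rightarrow> nat \<Rightarrow> (real^2 \<Rightarrow> real) \<Rightarrow> (real^2 \<Rightarrow> real^2) \<Rightarrow> bool" where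
  "averaging_flux M A g m u \<sigma> \<longleftrightarrow> \<sigma> \<in> RT M m \<and>
     (\<forall>F\<in>edges M - N_edges M. \<forall>\<phi>\<in>Pol m.
        edge_integral F (\<lambda>x. normal_tr M F \<sigma> x * \<phi> x) =
        - edge_integral F (\<lambda>x. weighted_average M A F (\<lambda>y. (A y *v grad u y) \<bullet> nrm M F) x * \<phi> x)) \<and>
     (\<forall>F\<in>N_edges M. \<forall>\<phi>\<in>Pol m.
        edge_integral F (\<lambda>x. normal_tr M F \<sigma> x * \<phi> x) = edge_integral F (\<lambda>x. g x * \<phi> x)) \<and>
     (1 \<le> m \<longrightarrow> (\<forall>K\<in>Th M. \<forall>\<psi>\<in>Pol_vec (m - 1).
        L2_inner K \<sigma> \<psi> = - L2_inner K (\<lambda>x. A x *v grad u x) \<psi>))"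

definition residual ::
  "fe_mesh \<Rightarrow> (real^2 \<Rightarrow> real) \<Rightarrow> (real^2 \<Rightarrow> real^2) \<Rightarrow> (real^2 \<Rightarrow> real) \<Rightarrow> real" where
  "residual M f \<sigma> v = L2_inner (Dom M) (\<lambda>x. f x - weak_div (Dom M) \<sigma> x) v"


section \<open>Local minimization\<close>

definition weighted_norm ::
  "fe_mesh \<Rightarrow> (real^2 \<Rightarrow> real^2^2) \<Rightarrow> real^2 \<Rightarrow> (real^2 \<Rightarrow> real^2) \<Rightarrow> real" where
  "weighted_norm M A z \<tau> = L2_norm (omega M z) (\<lambda>x. inv_sqrt (A x) *v \<tau> x)"

definition minimized ::
  "fe_mesh \<Rightarrow> (real^2 \<Rightarrow> real^2^2) \<Rightarrow> real^2 \<Rightarrow> (real^2 \<Rightarrow> real^2) \<Rightarrow> (real^2 \<Rightarrow> real^2) \<Rightarrow> real^2 \<Rightarrow> real^2" where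
  "minimized M A z \<sigma> \<sigma>' =
     (let c = (ARG_MIN (\<lambda>l. weighted_norm M A z (\<lambda>x. \<sigma> x - l *\<^sub>R \<sigma>' x)) l. True)
      in (\<lambda>x. \<sigma> x - c *\<^sub>R \<sigma>' x))"

definition global_correction ::
  "fe_mesh \<Rightarrow> (real^2 \<Rightarrow> real^2^2) \<Rightarrow> (real^2 \<Rightarrow> real^2 \<Rightarrow> real^2) \<Rightarrow> (real^2 \<Rightarrow> real^2 \<Rightarrow> real^2)
     \<Rightarrow> real^2 \<Rightarrow> real^2" where
  "global_correction M A \<sigma> \<sigma>' x =
     (\<Sum>z\<in>vertices_star M. minimized M A z (\<sigma> z) (\<sigma>' z) x) +
     (\<Sum>z\<in>vertices M - vertices_star M. \<sigma> z x)"

definition coeff_c ::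
  "fe_mesh \<Rightarrow> (real^2 \<Rightarrow> real^2^2) \<Rightarrow> real^2 \<Rightarrow> (real^2 \<Rightarrow> real^2) \<Rightarrow> (real^2 \<Rightarrow> real^2) \<Rightarrow> real" where
  "coeff_c M A z \<sigma> \<sigma>' = L2_inner (omega M z) (\<lambda>x. matrix_inv (A x) *v \<sigma> x) \<sigma>'"

end

theory Submission
  imports Defs
begin

text \<open>
  The hat functions form a partition of unity, so \<open>r(v)\<close> is the sum over the vertices of \<open>r(v \<lambda>\<^sub>z)\<close>, and
  \<open>v\<close> may be replaced there by its restriction to the patch of \<open>z\<close>, which is an admissible test
  function for the local problem. Conversely the local flux at \<open>z\<close> has vanishing normal traces on all
  edges not containing \<open>z\<close>: such an edge of a patch element lies on the boundary of the patch. Hence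
  the local form equals the global form, and the local equations add up. The kernel fields contribute
  nothing, whatever their coefficients. The minimizing coefficient is \<open>c\<^sub>z\<close> because the squared norm
  is a monic quadratic in it, by the normalization of the kernel field.
\<close>

section \<open>Piecewise continuous fields and their traces\<close>

text \<open>A common weakening of \<open>DG_on\<close> and \<open>RT_on\<close> that leaves the
  values on edges free. The witness is continuous on the whole plane, so that for a triangle its
  values on the edges are the traces.\<close>

definition pw_continuous :: "(real^2) set set \<Rightarrow> (real^2 \<Rightarrow> 'b::real_normed_vector) \<Rightarrow> bool" where
  "pw_continuous P v \<longleftrightarrow> (\<forall>K\<in>P. \<exists>p. continuous_on UNIV p \<and> (\<forall>x\<in>interior K. v x = p x))"

lemma pw_continuous_mono: "pw_continuous P v \<Longrightarrow> Q \<subseteq> P \<Longrightarrow> pw_continuous Q v"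
  unfolding pw_continuous_def by blast

lemma pw_continuous_zero [simp]: "pw_continuous P (\<lambda>x. 0)"
  unfolding pw_continuous_def using continuous_on_const by blast

lemma pw_continuous_map:
  assumes "pw_continuous P v" "\<And>p :: real^2 \<Rightarrow> _. continuous_on UNIV p \<Longrightarrow> continuous_on UNIV (\<lambda>x. h (p x))"
  shows "pw_continuous P (\<lambda>x. h (v x))"
  unfolding pw_continuous_def
proof
  fix K assume "K \<in> P"
  then obtain p where p: "continuous_on UNIV p" "\<forall>x\<in>interior K. v x = p x"
    using assms(1) unfolding pw_continuous_def by blast
  show "\<exists>p. continuous_on UNIV p \<and> (\<forall>x\<in>interior K. h (v x) = p x)"
    by (intro exI[of _ "\<lambda>x. h (p x)"] conjI assms(2) p(1)) (simp add: p(2))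
qed

lemma pw_continuous_map2:
  assumes "pw_continuous P v" "pw_continuous P w"
    "\<And>p q :: real^2 \<Rightarrow> _. continuous_on UNIV p \<Longrightarrow> continuous_on UNIV q \<Longrightarrow> continuous_on UNIV (\<lambda>x. h (p x) (q x))"
  shows "pw_continuous P (\<lambda>x. h (v x) (w x))"
  unfolding pw_continuous_def
proof
  fix K assume K: "K \<in> P"
  obtain p where p: "continuous_on UNIV p" "\<forall>x\<in>interior K. v x = p x"
    using assms(1) K unfolding pw_continuous_def by blast
  obtain q where q: "continuous_on UNIV q" "\<forall>x\<in>interior K. w x = q x"
    using assms(2) K unfolding pw_continuous_def by blast
  show "\<exists>p. continuous_on UNIV p \<and> (\<forall>x\<in>interior K. h (v x) (w x) = p x)"
    by (intro exI[of _ "\<lambda>x. h (p x) (q x)"] conjI assms(3) p(1) q(1)) (simp add: p(2) q(2))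
qed

lemma pw_continuous_add: "pw_continuous P v \<Longrightarrow> pw_continuous P w \<Longrightarrow> pw_continuous P (\<lambda>x. v x + w x)"
  by (rule pw_continuous_map2[where h="(+)"]) (auto intro: continuous_intros)

lemma pw_continuous_scaleR: "pw_continuous P v \<Longrightarrow> pw_continuous P (\<lambda>x. c *\<^sub>R v x)"
  by (rule pw_continuous_map[where h="\<lambda>y. c *\<^sub>R y"]) (auto intro: continuous_intros)

lemma pw_continuous_mult: "pw_continuous P v \<Longrightarrow> pw_continuous P w \<Longrightarrow> pw_continuous P (\<lambda>x. v x * w x :: real)"
  by (rule pw_continuous_map2[where h="(*)"]) (auto intro: continuous_intros)

lemma pw_continuous_inner: "pw_continuous P v \<Longrightarrow> pw_continuous P w \<Longrightarrow> pw_continuous P (\<lambda>x. v x \<bullet> w x)"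
  by (rule pw_continuous_map2[where h="(\<bullet>)"]) (auto intro: continuous_intros)

lemma pw_continuous_sum: "(\<And>i. i \<in> I \<Longrightarrow> pw_continuous P (v i)) \<Longrightarrow> pw_continuous P (\<lambda>x. \<Sum>i\<in>I. v i x)"
  by (induction I rule: infinite_finite_induct) (auto intro: pw_continuous_add)

lemma continuous_on_Pol: "p \<in> Pol m \<Longrightarrow> continuous_on UNIV p"
proof -
  assume "p \<in> Pol m"
  then obtain c where "p = (\<lambda>x. \<Sum>i\<le>m. \<Sum>j\<le>m - i. c i j * (x $ 1) ^ i * (x $ 2) ^ j)"
    unfolding Pol_def by blast
  then show ?thesis by (auto intro!: continuous_intros)
qed

lemma continuous_on_Pol_vec:
  assumes "p \<in> Pol_vec m"
  shows "continuous_on UNIV p"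
proof -
  have "continuous_on UNIV (\<lambda>x. \<chi> i. p x $ i)"
    using assms continuous_on_Pol unfolding Pol_vec_def by (intro continuous_on_vec_lambda) blast
  then show ?thesis by simp
qed

lemma pw_continuous_DG_on: "v \<in> DG_on U P m \<Longrightarrow> pw_continuous P v"
  unfolding DG_on_def pw_continuous_def using continuous_on_Pol by blast

lemma pw_continuous_RT_on: "\<tau> \<in> RT_on U P m \<Longrightarrow> pw_continuous P \<tau>"
  unfolding pw_continuous_def
proof
  fix K assume "\<tau> \<in> RT_on U P m" "K \<in> P"
  then obtain p q where "p \<in> Pol_vec m" "q \<in> Pol m" "\<forall>x\<in>interior K. \<tau> x = p x + q x *\<^sub>R x"
    unfolding RT_on_def by blast
  then show "\<exists>p. continuous_on UNIV p \<and> (\<forall>x\<in>interior K. \<tau> x = p x)"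
    using continuous_on_Pol continuous_on_Pol_vec
    by (intro exI[of _ "\<lambda>x. p x + q x *\<^sub>R x"]) (auto intro!: continuous_intros)
qed

section \<open>Triangles and traces on their boundary\<close>

lemma simplex_interior_nonempty:
  fixes K :: "(real^2) set"
  assumes "2 simplex K"
  shows "interior K \<noteq> {}"
proof -
  have "aff_dim K = 2" using aff_dim_simplex assms by blast
  then show ?thesis
    using interior_rel_interior_gen[of K] rel_interior_eq_empty[of K] convex_simplex[OF assms] by auto
qed

lemma simplex_closure_interior:
  fixes K :: "(real^2) set"
  assumes "2 simplex K"
  shows "closure (interior K) = K"
  using convex_closure_interior[OF convex_simplex simplex_interior_nonempty] assms closed_simplex
  by (metis closure_closed)

text \<open>\<open>Lim\<close> is a \<open>THE\<close>, meaningful only along a nontrivial filter.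
  Here it is nontrivial because \<open>K\<close> is the closure of its interior, so each point of
  \<open>K\<close> is a limit point of that interior.\<close>

lemma tr_tendsto:
  fixes v :: "real^2 \<Rightarrow> 'b::real_normed_vector"
  assumes K: "2 simplex K" and x: "x \<in> K"
    and p: "continuous_on UNIV p" "\<forall>y\<in>interior K. v y = p y"
  shows "tr K v x = p x"
proof -
  have "x islimpt interior K"
  proof (cases "x \<in> interior K")
    case True then show ?thesis by (simp add: interior_limit_point)
  next
    case False
    then show ?thesis using simplex_closure_interior[OF K] x closure_def by blast
  qed
  then have nt: "\<not> trivial_limit (at x within interior K)"
    by (simp add: trivial_limit_within)
  have "(p \<longlongrightarrow> p x) (at x within interior K)"
    using p(1) by (meson continuous_on_def UNIV_I tendsto_within_subset subset_UNIV)
  then have "(v \<longlongrightarrow> p x) (at x within interior K)"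
    by (rule Lim_transform_eventually) (use p(2) in \<open>auto simp: eventually_at_filter\<close>)
  then show ?thesis
    unfolding tr_def using nt tendsto_Lim by blast
qed

text \<open>Eventual equality along the filter suffices whether or not a limit exists, so this
  applies to functions of no known regularity.\<close>

lemma tr_cong:
  fixes v w :: "real^2 \<Rightarrow> 'b::real_normed_vector"
  assumes "\<And>y. y \<in> interior K \<Longrightarrow> v y = w y"
  shows "tr K v x = tr K w x"
proof -
  have "\<forall>\<^sub>F y in at x within interior K. v y = w y"
    using assms by (auto simp: eventually_at_filter)
  then show ?thesis unfolding tr_def by (rule Lim_cong[OF _ refl])
qed

section \<open>Integrals over edges\<close>

text \<open>A facet of a triangle is compact, convex and collinear, hence a segment. One
  parametrization is fixed for all integrands, which hides the \<open>SOME\<close> in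
  \<open>edge_integral\<close>.\<close>

lemma segment_facet:
  fixes K :: "(real^2) set"
  assumes "2 simplex K" "F facet_of K"
  obtains a b where "F = closed_segment a b" "\<And>t. 0 \<le> t \<Longrightarrow> t \<le> 1 \<Longrightarrow> a + t *\<^sub>R (b - a) \<in> F"
    "\<And>\<phi>. edge_integral F \<phi> = dist a b * integral\<^sup>L (lebesgue_on {0..1}) (\<lambda>t. \<phi> (a + t *\<^sub>R (b - a)))"
proof -
  have F: "F face_of K" "F \<noteq> {}" "aff_dim F = 1"
    using assms aff_dim_simplex[OF assms(1)] unfolding facet_of_def by auto
  have "compact F" using F compact_simplex[OF assms(1)] convex_simplex[OF assms(1)] face_of_imp_compact by blast
  moreover have "convex F" using F face_of_imp_convex by blast
  moreover have "collinear F" by (simp add: collinear_aff_dim F(3))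
  ultimately obtain c d where cd: "F = closed_segment c d"
    using compact_convex_collinear_segment F(2) by metis
  \<comment> \<open>Literally the choice made in \<open>edge_integral\<close>, so that its
    definition folds to this pair.\<close>
  define ab where "ab = (SOME ab. F = closed_segment (fst ab) (snd ab))"
  have *: "F = closed_segment (fst ab) (snd ab)"
    unfolding ab_def by (rule someI[of _ "(c, d)"]) (simp add: cd)
  have m: "fst ab + t *\<^sub>R (snd ab - fst ab) \<in> F" if "0 \<le> t" "t \<le> 1" for t
    using that unfolding * closed_segment_def
    by (auto intro!: exI[of _ t] simp: algebra_simps)
  have "edge_integral F \<phi> = dist (fst ab) (snd ab) *
      integral\<^sup>L (lebesgue_on {0..1}) (\<lambda>t. \<phi> (fst ab + t *\<^sub>R (snd ab - fst ab)))" for \<phi>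
    unfolding edge_integral_def ab_def[symmetric] by (simp add: case_prod_beta)
  with * m that show ?thesis by blast
qed

lemma edge_integral_cong:
  fixes K :: "(real^2) set"
  assumes "2 simplex K" "F facet_of K" "\<And>x. x \<in> F \<Longrightarrow> \<phi> x = \<psi> x"
  shows "edge_integral F \<phi> = edge_integral F \<psi>"
proof -
  obtain a b where ab: "\<And>t. 0 \<le> t \<Longrightarrow> t \<le> 1 \<Longrightarrow> a + t *\<^sub>R (b - a) \<in> F"
    "\<And>\<phi>. edge_integral F \<phi> = dist a b * integral\<^sup>L (lebesgue_on {0..1}) (\<lambda>t. \<phi> (a + t *\<^sub>R (b - a)))"
    using segment_facet[OF assms(1,2)] by metis
  have "integral\<^sup>L (lebesgue_on {0..1}) (\<lambda>t. \<phi> (a + t *\<^sub>R (b - a)))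
      = integral\<^sup>L (lebesgue_on {0..1}) (\<lambda>t. \<psi> (a + t *\<^sub>R (b - a)))"
    by (rule Bochner_Integration.integral_cong) (auto simp: assms(3) ab(1))
  then show ?thesis unfolding ab(2) by simp
qed

lemma edge_integral_zero: "edge_integral F (\<lambda>x. 0) = 0"
  unfolding edge_integral_def by (simp add: case_prod_beta)

lemma edge_integral_scale:
  "edge_integral F (\<lambda>x. c * \<phi> x) = c * edge_integral F \<phi>"
  unfolding edge_integral_def by (simp add: case_prod_beta)

text \<open>The Bochner integral of a nonintegrable function is 0, so additivity requires
  integrability; continuity on the compact segment provides it.\<close>

lemma edge_integral_add:
  fixes K :: "(real^2) set"
  assumes "2 simplex K" "F facet_of K"
    and \<phi>: "continuous_on F \<phi>" and \<psi>: "continuous_on F \<psi>"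
  shows "edge_integral F (\<lambda>x. \<phi> x + \<psi> x) = edge_integral F \<phi> + edge_integral F \<psi>"
proof -
  obtain a b where ab: "\<And>t. 0 \<le> t \<Longrightarrow> t \<le> 1 \<Longrightarrow> a + t *\<^sub>R (b - a) \<in> F"
    "\<And>\<phi>. edge_integral F \<phi> = dist a b * integral\<^sup>L (lebesgue_on {0..1}) (\<lambda>t. \<phi> (a + t *\<^sub>R (b - a)))"
    using segment_facet[OF assms(1,2)] by metis
  have int: "integrable (lebesgue_on {0..1}) (\<lambda>t. \<xi> (a + t *\<^sub>R (b - a)))"
    if "continuous_on F \<xi>" for \<xi> :: "real^2 \<Rightarrow> real"
  proof (rule continuous_imp_integrable_real)
    show "continuous_on {0..1} (\<lambda>t. \<xi> (a + t *\<^sub>R (b - a)))"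
      by (rule continuous_on_compose2[OF that]) (auto intro!: continuous_intros ab(1))
  qed
  show ?thesis unfolding ab(2) using int[OF \<phi>] int[OF \<psi>] by (simp add: algebra_simps)
qed

section \<open>Triangulations\<close>

text \<open>The part of \<open>regular_triangulation\<close> that speaks of the triangles alone;
  unlike the full notion it passes to subfamilies such as a patch.\<close>

definition triangles :: "(real^2) set set \<Rightarrow> bool" where
  "triangles T \<longleftrightarrow> triangulation T \<and> (\<forall>K\<in>T. 2 simplex K)"

lemma triangles_subset: "triangles T \<Longrightarrow> P \<subseteq> T \<Longrightarrow> triangles P"
  unfolding triangles_def triangulation_def by (meson finite_subset subsetD)

lemma triangles_finite: "triangles T \<Longrightarrow> finite T"
  unfolding triangles_def triangulation_def by blast

lemma triangles_simplex: "triangles T \<Longrightarrow> K \<in> T \<Longrightarrow> 2 simplex K"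
  unfolding triangles_def by blast

lemma triangles_face: "triangles T \<Longrightarrow> K \<in> T \<Longrightarrow> K' \<in> T \<Longrightarrow> K \<inter> K' face_of K"
  unfolding triangles_def triangulation_def by blast

text \<open>A proper face has smaller dimension, but both triangles have dimension 2.\<close>

lemma triangles_eq:
  assumes "triangles T" "K \<in> T" "K' \<in> T" "K \<inter> K' = K"
  shows "K = K'"
proof (rule ccontr)
  assume "K \<noteq> K'"
  moreover have "K face_of K'"
    using triangles_face[OF assms(1,3,2)] assms(4) by (simp add: Int_commute)
  ultimately have "aff_dim K < aff_dim K'"
    using face_of_aff_dim_lt convex_simplex triangles_simplex assms by blast
  then show False
    using aff_dim_simplex[OF triangles_simplex[OF assms(1,2)]]
      aff_dim_simplex[OF triangles_simplex[OF assms(1,3)]] by simp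
qed

text \<open>The intersection is a face of \<open>K\<close> that meets the interior of
  \<open>K\<close>, and only \<open>K\<close> itself is such a face.\<close>

lemma triangles_interior:
  assumes "triangles T" "K \<in> T" "K' \<in> T" "x \<in> interior K" "x \<in> K'"
  shows "K = K'"
proof -
  have "x \<in> K" using assms(4) interior_subset by blast
  then have "(K \<inter> K') \<inter> interior K \<noteq> {}" using assms(4,5) by blast
  then have "K \<inter> K' = K"
    using face_of_disjoint_interior triangles_face assms(1-3) by blast
  then show ?thesis using triangles_eq assms(1-3) by blast
qed

section \<open>Integration of piecewise continuous fields\<close>

text \<open>The exceptional points lie on the frontiers of finitely many convex sets, which are null
  sets.\<close>

lemma AE_triangles_interior:
  assumes T: "triangles T" and S: "S \<in> sets lebesgue" "S \<subseteq> \<Union>T"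
  shows "negligible (S - (\<Union>K\<in>T. interior K))"
    and "AE x in lebesgue_on S. \<exists>K\<in>T. x \<in> interior K"
proof -
  have "negligible (\<Union>K\<in>T. frontier K)"
    using triangles_finite[OF T] triangles_simplex[OF T] convex_simplex negligible_convex_frontier
    by (intro negligible_Union) auto
  moreover have "S - (\<Union>K\<in>T. interior K) \<subseteq> (\<Union>K\<in>T. frontier K)"
  proof
    fix x assume "x \<in> S - (\<Union>K\<in>T. interior K)"
    moreover from this obtain K where "K \<in> T" "x \<in> K" using S(2) by blast
    ultimately show "x \<in> (\<Union>K\<in>T. frontier K)"
      unfolding frontier_def using closure_subset[of K] by (intro UN_I[of K]) auto
  qed
  ultimately show n: "negligible (S - (\<Union>K\<in>T. interior K))"
    using negligible_subset by blast
  then have "AE x in lebesgue. x \<notin> S - (\<Union>K\<in>T. interior K)"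
    unfolding negligible_iff_null_sets by (rule AE_not_in)
  then show "AE x in lebesgue_on S. \<exists>K\<in>T. x \<in> interior K"
    using S(1) by (subst AE_restrict_space_iff) auto
qed

text \<open>Measurability is part of the claim: \<open>v\<close> agrees off a null set with a
  bounded Borel function.\<close>

lemma pw_continuous_integrable:
  fixes v :: "real^2 \<Rightarrow> 'b::euclidean_space"
  assumes T: "triangles T" and v: "pw_continuous T v" and S: "S \<in> lmeasurable" "S \<subseteq> \<Union>T"
  shows "integrable (lebesgue_on S) v"
proof -
  have Sl: "S \<in> sets lebesgue" using S by blast
  obtain p where p: "\<And>K. K \<in> T \<Longrightarrow> continuous_on UNIV (p K)"
    "\<And>K x. K \<in> T \<Longrightarrow> x \<in> interior K \<Longrightarrow> v x = p K x"
    using v unfolding pw_continuous_def by metis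
  \<comment> \<open>A representative of \<open>v\<close> that is zero off the open triangles. These
    are disjoint, so at most one summand is nonzero at each point.\<close>
  define g where "g x = (\<Sum>K\<in>T. indicat_real (interior K) x *\<^sub>R p K x)" for x
  have g: "integrable (lebesgue_on S) g"
    unfolding g_def
  proof (rule Bochner_Integration.integrable_sum)
    fix K assume K: "K \<in> T"
    interpret finite_measure "lebesgue_on S" using S finite_measure_lebesgue_on by blast
    have "compact K" using triangles_simplex[OF T K] compact_simplex by blast
    then have "compact (p K ` K)"
      using p(1)[OF K] compact_continuous_image continuous_on_subset by blast
    then obtain B where B: "\<And>x. x \<in> K \<Longrightarrow> norm (p K x) \<le> B"
      using compact_imp_bounded[of "p K ` K"] unfolding bounded_iff by auto
    have "norm (indicat_real (interior K) x *\<^sub>R p K x) \<le> max B 0" for x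
      using B[of x] interior_subset[of K] by (auto simp: indicator_def)
    moreover have "(\<lambda>x. indicat_real (interior K) x *\<^sub>R p K x) \<in> borel_measurable borel"
      using p(1)[OF K] by (intro borel_measurable_scaleR borel_measurable_indicator
          borel_measurable_continuous_onI) auto
    then have "(\<lambda>x. indicat_real (interior K) x *\<^sub>R p K x) \<in> borel_measurable (lebesgue_on S)"
      by (intro measurable_restrict_space1 measurable_completion) simp
    ultimately show "integrable (lebesgue_on S) (\<lambda>x. indicat_real (interior K) x *\<^sub>R p K x)"
      by (intro integrable_const_bound[where B="max B 0"]) auto
  qed
  have eq: "v x = g x" if x: "x \<in> interior K" and K: "K \<in> T" for x K
  proof -
    have "indicat_real (interior K') x *\<^sub>R p K' x = (if K' = K then v x else 0)" if "K' \<in> T" for K'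
      using triangles_interior[OF T that K, of x] p(2)[OF K x] x that interior_subset[of K]
      by (auto simp: indicator_def)
    then have "g x = (\<Sum>K'\<in>T. if K' = K then v x else 0)" unfolding g_def by simp
    also have "\<dots> = v x" using K triangles_finite[OF T] by simp
    finally show ?thesis by simp
  qed
  \<comment> \<open>Equality with \<open>g\<close> off a null set yields measurability of
    \<open>v\<close> because the measure is complete; only then can integrability be
    transferred.\<close>
  have "v measurable_on S"
  proof (rule measurable_on_spike)
    show "g measurable_on S"
      using g Sl by (simp add: measurable_on_iff_borel_measurable borel_measurable_integrable)
    show "negligible (S - (\<Union>K\<in>T. interior K))" using AE_triangles_interior T S Sl by blast
    show "v x = g x" if "x \<in> S - (S - (\<Union>K\<in>T. interior K))" for x using that eq by auto
  qed
  then have "v \<in> borel_measurable (lebesgue_on S)"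
    using Sl by (simp add: measurable_on_iff_borel_measurable)
  moreover have "AE x in lebesgue_on S. g x = v x"
    using AE_triangles_interior(2)[OF T Sl S(2)] by eventually_elim (metis eq)
  ultimately show ?thesis
    by (rule integrable_cong_AE_imp[OF g])
qed

lemma pw_continuous_integral_cong:
  fixes v w :: "real^2 \<Rightarrow> 'b::euclidean_space"
  assumes T: "triangles T" and v: "pw_continuous T v" "pw_continuous T w" and S: "S \<in> lmeasurable" "S \<subseteq> \<Union>T"
    and eq: "\<And>K x. K \<in> T \<Longrightarrow> x \<in> interior K \<Longrightarrow> v x = w x"
  shows "integral\<^sup>L (lebesgue_on S) v = integral\<^sup>L (lebesgue_on S) w"
proof (rule integral_cong_AE)
  show "v \<in> borel_measurable (lebesgue_on S)" "w \<in> borel_measurable (lebesgue_on S)"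
    by (rule borel_measurable_integrable[OF pw_continuous_integrable[OF T _ S]], fact v)+
  have "S \<in> sets lebesgue" using S by blast
  from AE_triangles_interior(2)[OF T this S(2)]
  show "AE x in lebesgue_on S. v x = w x"
    by eventually_elim (metis eq)
qed

lemma pw_continuous_L2:
  fixes v :: "real^2 \<Rightarrow> 'b::euclidean_space"
  assumes T: "triangles T" and v: "pw_continuous T v" and S: "S \<in> lmeasurable" "S \<subseteq> \<Union>T"
  shows "L2 S v"
  unfolding L2_def
proof
  show "v \<in> borel_measurable (lebesgue_on S)"
    by (rule borel_measurable_integrable[OF pw_continuous_integrable[OF T v S]])
  have "pw_continuous T (\<lambda>x. v x \<bullet> v x)" by (rule pw_continuous_inner[OF v v])
  then show "integrable (lebesgue_on S) (\<lambda>x. (norm (v x))\<^sup>2)"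
    unfolding power2_norm_eq_inner by (rule pw_continuous_integrable[OF T _ S])
qed

text \<open>Domination by the sum of the squares.\<close>

lemma L2_product_integrable:
  fixes f g :: "real^2 \<Rightarrow> real"
  assumes "L2 U f" "L2 U g"
  shows "integrable (lebesgue_on U) (\<lambda>x. f x * g x)"
proof (rule Bochner_Integration.integrable_bound)
  show "integrable (lebesgue_on U) (\<lambda>x. (norm (f x))\<^sup>2 + (norm (g x))\<^sup>2)"
    using assms unfolding L2_def by simp
  show "(\<lambda>x. f x * g x) \<in> borel_measurable (lebesgue_on U)"
    using assms unfolding L2_def by (intro borel_measurable_times) blast+
  have "\<bar>a * b\<bar> \<le> a\<^sup>2 + b\<^sup>2" for a b :: real
  proof -
    have "2 * (\<bar>a\<bar> * \<bar>b\<bar>) \<le> a\<^sup>2 + b\<^sup>2"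
      using sum_squares_bound[of "\<bar>a\<bar>" "\<bar>b\<bar>"] by simp
    moreover have "0 \<le> \<bar>a\<bar> * \<bar>b\<bar>" by simp
    ultimately show ?thesis unfolding abs_mult by linarith
  qed
  then show "AE x in lebesgue_on U. norm (f x * g x) \<le> norm ((norm (f x))\<^sup>2 + (norm (g x))\<^sup>2)"
    by (intro AE_I2) (simp add: abs_of_nonneg)
qed

section \<open>Vertices and facets of patch elements\<close>

text \<open>The triangles share the face \<open>K \<inter> K'\<close>, and extremality of a point of
  a face is the same in the face and in the triangle. Thus a triangle that contains the vertex
  \<open>z\<close> already belongs to the patch.\<close>

lemma triangles_vertex:
  assumes T: "triangles T" and K: "K \<in> T" "K' \<in> T" "z extreme_point_of K'" "z \<in> K"
  shows "z extreme_point_of K"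
proof -
  have "z \<in> K'" using K(3) extreme_point_of_def by blast
  then have "z extreme_point_of (K' \<inter> K)"
    using extreme_point_of_face[OF triangles_face[OF T K(2,1)]] K by blast
  then show ?thesis
    using extreme_point_of_face[OF triangles_face[OF T K(1,2)]] by (simp add: Int_commute)
qed

text \<open>At a point of the relative interior of such a facet no other triangle of the patch can be
  present, so that locally the patch is a single triangle with that point on its boundary.\<close>

lemma facet_opposite_frontier:
  assumes T: "triangles T" and K: "K \<in> T" "z extreme_point_of K"
    and F: "F facet_of K" "z \<notin> F"
  shows "F \<subseteq> frontier (\<Union>{K\<in>T. z extreme_point_of K})"
proof -
  define W where "W = \<Union>{K\<in>T. z extreme_point_of K}"
  note cl = closed_simplex[OF triangles_simplex[OF T]]
  have clW: "closed W" unfolding W_def using cl triangles_finite[OF T] by (intro closed_Union) auto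
  have FK: "F face_of K" "F \<noteq> K" "F \<subseteq> K"
    using F(1) facet_of_imp_face_of facet_of_irrefl facet_of_imp_subset by blast+
  have cF: "convex F" "closed F"
    using FK(1) face_of_imp_convex convex_simplex cl[OF K(1)] triangles_simplex[OF T K(1)]
      face_of_imp_closed by blast+
  have aF: "aff_dim F = 1"
    using F(1) aff_dim_simplex[OF triangles_simplex[OF T K(1)]] unfolding facet_of_def by auto
  have "rel_interior F \<subseteq> frontier W"
  proof
    fix x assume x: "x \<in> rel_interior F"
    then have xF: "x \<in> F" using rel_interior_subset by blast
    \<comment> \<open>\<open>F\<close> lies in the face \<open>K \<inter> K''\<close> and is a
      proper face of it, since \<open>z\<close> is missing from \<open>F\<close>. That face has
      therefore dimension greater than 1, which leaves only \<open>K\<close> itself.\<close>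
    have only: "K'' = K" if "K'' \<in> T" "z extreme_point_of K''" "x \<in> K''" for K''
    proof -
      have f: "K \<inter> K'' face_of K" using triangles_face[OF T K(1) that(1)] .
      have zz: "z \<in> K \<inter> K''" using K(2) that(2) extreme_point_of_def by blast
      have "(K \<inter> K'') \<inter> rel_interior F \<noteq> {}" using x xF that FK by blast
      then have sub: "F \<subseteq> K \<inter> K''" using subset_of_face_of[OF f FK(3)] by blast
      have "F face_of K \<inter> K''" using FK(1) sub by (meson face_of_subset Int_lower1)
      moreover have "F \<noteq> K \<inter> K''" using zz F(2) by blast
      ultimately have "aff_dim F < aff_dim (K \<inter> K'')"
        using face_of_aff_dim_lt convex_simplex triangles_simplex[OF T] K(1) that(1)
        by (meson convex_Int)
      moreover have "aff_dim (K \<inter> K'') < aff_dim K" if "K \<inter> K'' \<noteq> K"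
        using face_of_aff_dim_lt[OF _ f that] convex_simplex triangles_simplex[OF T K(1)] by blast
      ultimately have "K \<inter> K'' = K"
        using aF aff_dim_simplex[OF triangles_simplex[OF T K(1)]] by linarith
      then show ?thesis using triangles_eq[OF T K(1) that(1)] by blast
    qed
    have xW: "x \<in> W" unfolding W_def using xF FK K by blast
    moreover have "x \<notin> interior W"
    proof
      assume xi: "x \<in> interior W"
      \<comment> \<open>The rest of the patch. It is closed and misses \<open>x\<close>, so an
        interior point \<open>x\<close> of \<open>W\<close> would be interior to \<open>K\<close>,
        impossible on a proper face.\<close>
      define R where "R = \<Union>({K\<in>T. z extreme_point_of K} - {K})"
      have "closed R" unfolding R_def using cl triangles_finite[OF T] by (intro closed_Union) auto
      then have "open (interior W - R)" by (simp add: open_Diff)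
      moreover have "x \<in> interior W - R" using xi only unfolding R_def by blast
      moreover have "interior W - R \<subseteq> K"
        using interior_subset[of W] unfolding W_def R_def by blast
      ultimately have "x \<in> interior K" by (meson interiorI)
      then show False using face_of_disjoint_interior[OF FK(1,2)] xF by blast
    qed
    ultimately show "x \<in> frontier W" using clW by (simp add: frontier_def)
  qed
  then have "closure (rel_interior F) \<subseteq> frontier W"
    by (simp add: closure_minimal frontier_closed)
  then show ?thesis
    using convex_closure_rel_interior[OF cF(1)] cF(2) unfolding W_def by simp
qed

text \<open>A sum of functions affine on a triangle is affine, hence determined by the vertices.\<close>

lemma affine_partition_of_unity:
  assumes K: "2 simplex K" and V: "finite V"
    and aff: "\<And>z. z \<in> V \<Longrightarrow> \<exists>a b. \<forall>x\<in>K. l z x = a + b \<bullet> x"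
    and one: "\<And>y. y extreme_point_of K \<Longrightarrow> (\<Sum>z\<in>V. l z y) = c"
    and x: "x \<in> K"
  shows "(\<Sum>z\<in>V. l z x :: real) = c"
proof -
  obtain a b where ab: "\<And>z x. z \<in> V \<Longrightarrow> x \<in> K \<Longrightarrow> l z x = a z + b z \<bullet> x"
    using aff by metis
  define B where "B = (\<Sum>z\<in>V. b z)"
  \<comment> \<open>The level set of the affine sum, taken in the whole plane so that it is convex;
    for \<open>B = 0\<close> it degenerates to the plane or to the empty set.\<close>
  define H where "H = {y. B \<bullet> y = c - (\<Sum>z\<in>V. a z)}"
  have H: "y \<in> H \<longleftrightarrow> (\<Sum>z\<in>V. l z y) = c" if "y \<in> K" for y
    using ab that unfolding H_def B_def by (auto simp: sum.distrib inner_sum_left)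
  have "{y. y extreme_point_of K} \<subseteq> H"
    using one H extreme_point_of_def by blast
  moreover have "convex H" unfolding H_def by (rule convex_hyperplane)
  ultimately have "convex hull {y. y extreme_point_of K} \<subseteq> H" by (rule hull_minimal)
  then have "K \<subseteq> H"
    using Krein_Milman_Minkowski[OF compact_simplex[OF K] convex_simplex[OF K]] by simp
  then show ?thesis using H x by blast
qed

lemma finite_vertices:
  assumes "triangles (Th M)"
  shows "finite (vertices M)"
proof -
  have "vertices M = (\<Union>K\<in>Th M. {z. z extreme_point_of K})" unfolding vertices_def by blast
  then show ?thesis
    using triangles_finite[OF assms]
      finite_polyhedron_extreme_points[OF simplex_imp_polyhedron[OF triangles_simplex[OF assms]]]
    by simp
qed

section \<open>Localization to vertex patches\<close>

lemma admissible_triangles: "admissible_mesh M \<Longrightarrow> triangles (Th M)"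
  unfolding admissible_mesh_def regular_triangulation_def triangles_def by blast

lemma admissible_dom:
  assumes "admissible_mesh M"
  shows "Dom M \<in> lmeasurable" "Dom M \<subseteq> \<Union>(Th M)"
proof -
  have "open (Dom M)" "bounded (Dom M)" "\<Union>(Th M) = closure (Dom M)"
    using assms unfolding admissible_mesh_def polygonal_domain_def regular_triangulation_def by blast+
  then show "Dom M \<in> lmeasurable" "Dom M \<subseteq> \<Union>(Th M)"
    using closure_subset by (simp_all add: lmeasurable_open)
qed

lemma admissible_Km:
  assumes "admissible_mesh M" "F \<in> edges M"
  shows "Km M F \<in> Th M" "F facet_of Km M F" "F \<subseteq> Km M F" "2 simplex Km M F"
proof -
  show "Km M F \<in> Th M" "F facet_of Km M F"
    using assms unfolding admissible_mesh_def edge_orientation_def by blast+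
  then show "F \<subseteq> Km M F" "2 simplex Km M F"
    using facet_of_imp_subset triangles_simplex admissible_triangles[OF assms(1)] by blast+
qed

lemma admissible_Kp:
  assumes "admissible_mesh M" "F \<in> int_edges M"
  shows "Kp M F \<in> Th M" "F \<subseteq> Kp M F"
proof -
  have "Kp M F \<in> Th M" "F facet_of Kp M F"
    using assms unfolding admissible_mesh_def edge_orientation_def by blast+
  then show "Kp M F \<in> Th M" "F \<subseteq> Kp M F"
    using facet_of_imp_subset by blast+
qed

lemma finite_edges:
  assumes "triangles (Th M)"
  shows "finite (edges M)"
proof -
  have "edges M = (\<Union>K\<in>Th M. {F. F facet_of K})" unfolding edges_def by blast
  then show ?thesis
    using triangles_finite[OF assms]
      finite_polytope_facets[OF simplex_imp_polytope[OF triangles_simplex[OF assms]]]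
    by simp
qed

section \<open>Linearity of the jump form in the flux\<close>

lemma continuous_on_tr:
  assumes "pw_continuous T v" "K \<in> T" "2 simplex K" "F \<subseteq> K"
  shows "continuous_on F (tr K v)"
proof -
  obtain p where p: "continuous_on UNIV p" "\<forall>x\<in>interior K. v x = p x"
    using assms unfolding pw_continuous_def by blast
  then have "continuous_on F p" using continuous_on_subset by blast
  then show ?thesis
    by (rule continuous_on_eq) (use tr_tendsto[OF assms(3) _ p] assms(4) in auto)
qed

lemma tr_add_scale:
  assumes "pw_continuous T v" "pw_continuous T w" "K \<in> T" "2 simplex K" "x \<in> K"
  shows "tr K (\<lambda>x. v x + c *\<^sub>R w x) x = tr K v x + c *\<^sub>R tr K w x"
proof -
  obtain p where p: "continuous_on UNIV p" "\<forall>x\<in>interior K. v x = p x"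
    using assms(1,3) unfolding pw_continuous_def by blast
  obtain q where q: "continuous_on UNIV q" "\<forall>x\<in>interior K. w x = q x"
    using assms(2,3) unfolding pw_continuous_def by blast
  have "tr K (\<lambda>x. v x + c *\<^sub>R w x) x = p x + c *\<^sub>R q x"
    using p q by (intro tr_tendsto[OF assms(4,5)] continuous_intros) auto
  then show ?thesis using tr_tendsto[OF assms(4,5)] p q by metis
qed

text \<open>Normal traces and jumps of piecewise continuous fields are continuous on each edge, so
  the edge integrals split. The combined shape serves both finite sums (\<open>c = 1\<close>) and
  the subtraction of kernel fields.\<close>

lemma jump_form_add_scale:
  assumes M: "admissible_mesh M" and \<tau>: "pw_continuous (Th M) \<tau>" "pw_continuous (Th M) \<tau>'" and v: "pw_continuous (Th M) v"
    and Es: "Es \<subseteq> edges M"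
  shows "jump_form M Es (\<lambda>x. \<tau> x + c *\<^sub>R \<tau>' x) v = jump_form M Es \<tau> v + c * jump_form M Es \<tau>' v"
proof -
  have "edge_integral F (\<lambda>x. normal_tr M F (\<lambda>x. \<tau> x + c *\<^sub>R \<tau>' x) x * jump M F v x)
      = edge_integral F (\<lambda>x. normal_tr M F \<tau> x * jump M F v x)
        + c * edge_integral F (\<lambda>x. normal_tr M F \<tau>' x * jump M F v x)" if "F \<in> Es" for F
  proof -
    have F: "F \<in> edges M" using that Es by blast
    note Km = admissible_Km[OF M F]
    note Kp = admissible_Kp[OF M]
    note sp = triangles_simplex[OF admissible_triangles[OF M]]
    have n: "continuous_on F (normal_tr M F \<rho>)" if "pw_continuous (Th M) \<rho>" for \<rho>
      unfolding normal_tr_def using continuous_on_tr[OF that Km(1,4,3)]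
      by (intro continuous_intros)
    have j: "continuous_on F (jump M F v)"
    proof (cases "F \<in> int_edges M")
      case True
      then show ?thesis unfolding jump_def
        using continuous_on_tr[OF v Km(1,4,3)] continuous_on_tr[OF v Kp(1) sp[OF Kp(1)] Kp(2)]
        by (simp add: continuous_on_diff)
    next
      case False
      then show ?thesis unfolding jump_def
        using continuous_on_tr[OF v Km(1,4,3)] by simp
    qed
    have "edge_integral F (\<lambda>x. normal_tr M F (\<lambda>x. \<tau> x + c *\<^sub>R \<tau>' x) x * jump M F v x)
      = edge_integral F (\<lambda>x. normal_tr M F \<tau> x * jump M F v x
            + c * (normal_tr M F \<tau>' x * jump M F v x))"
    proof (rule edge_integral_cong[OF Km(4,2)])
      fix x assume "x \<in> F"
      then have "x \<in> Km M F" using Km(3) by blast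
      from tr_add_scale[OF \<tau> Km(1,4) this]
      show "normal_tr M F (\<lambda>x. \<tau> x + c *\<^sub>R \<tau>' x) x * jump M F v x
        = normal_tr M F \<tau> x * jump M F v x + c * (normal_tr M F \<tau>' x * jump M F v x)"
        unfolding normal_tr_def by (simp add: inner_add_left algebra_simps)
    qed
    also have "\<dots> = edge_integral F (\<lambda>x. normal_tr M F \<tau> x * jump M F v x)
        + edge_integral F (\<lambda>x. c * (normal_tr M F \<tau>' x * jump M F v x))"
      by (intro edge_integral_add[OF Km(4,2)] continuous_on_mult continuous_on_const n j \<tau>)
    finally show ?thesis by (simp add: edge_integral_scale)
  qed
  then show ?thesis
    unfolding jump_form_def by (simp add: sum.distrib sum_distrib_left)
qed

lemma jump_form_sum:
  assumes M: "admissible_mesh M" and \<tau>: "\<And>i. i \<in> I \<Longrightarrow> pw_continuous (Th M) (\<tau> i)" and v: "pw_continuous (Th M) v"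
    and Es: "Es \<subseteq> edges M"
  shows "jump_form M Es (\<lambda>x. \<Sum>i\<in>I. \<tau> i x) v = (\<Sum>i\<in>I. jump_form M Es (\<tau> i) v)"
proof -
  \<comment> \<open>With \<open>c = 1\<close> linearity reads \<open>J = J + J\<close> for the zero
    flux.\<close>
  have zero: "jump_form M Es (\<lambda>x. 0) v = 0"
    using jump_form_add_scale[OF M pw_continuous_zero pw_continuous_zero v Es, of 1] by simp
  show ?thesis
    using \<tau>
  proof (induction I rule: infinite_finite_induct)
    case (insert i I)
    have "jump_form M Es (\<lambda>x. \<tau> i x + 1 *\<^sub>R (\<Sum>i\<in>I. \<tau> i x)) v
        = jump_form M Es (\<tau> i) v + 1 * jump_form M Es (\<lambda>x. \<Sum>i\<in>I. \<tau> i x) v"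
      using insert.prems by (intro jump_form_add_scale[OF M _ _ v Es] pw_continuous_sum) auto
    then show ?case using insert by simp
  qed (simp_all add: zero)
qed

section \<open>Local fluxes and restricted test functions\<close>

text \<open>What the assembly uses of a local flux. The trace is the one from \<open>Km M F\<close>,
  which on the patch boundary may lie outside the patch.\<close>

definition patch_flux :: "fe_mesh \<Rightarrow> real^2 \<Rightarrow> (real^2 \<Rightarrow> real^2) \<Rightarrow> bool" where
  "patch_flux M z \<tau> \<longleftrightarrow> pw_continuous (Th M) \<tau> \<and>
     (\<forall>F\<in>edges M. z \<notin> F \<longrightarrow> (\<forall>x\<in>F. normal_tr M F \<tau> x = 0))"

lemma omega_interior:
  assumes "triangles (Th M)" "K \<in> Th M" "x \<in> interior K" "x \<in> omega M z"
  shows "K \<in> patch M z"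
  using assms triangles_interior[OF assms(1,2) _ assms(3)] unfolding omega_def patch_def by blast

text \<open>Let \<open>F\<close> be an edge without \<open>z\<close>. If \<open>Km M F\<close> is in
  the patch, then \<open>F\<close> lies on the patch boundary and the boundary condition applies,
  since its exception concerns only edges containing \<open>z\<close>. Otherwise the extension by
  zero makes the trace vanish.\<close>

lemma RT_ring_patch0_patch_flux:
  assumes M: "admissible_mesh M" and \<tau>: "\<tau> \<in> RT_ring_patch0 M z m"
  shows "patch_flux M z \<tau>"
  unfolding patch_flux_def
proof (intro conjI ballI impI)
  note T = admissible_triangles[OF M]
  have p: "pw_continuous (patch M z) \<tau>"
    using \<tau> unfolding RT_ring_patch0_def RT_ring_patch_def
    by (intro pw_continuous_RT_on[of _ "interior (omega M z)" _ m]) simp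
  have out: "\<tau> x = 0" if "x \<notin> omega M z" for x
    using \<tau> that unfolding RT_ring_patch0_def by simp
  have zero: "\<tau> x = 0" if "K \<in> Th M" "K \<notin> patch M z" "x \<in> interior K" for x K
    using omega_interior[OF T] out that by blast
  show "pw_continuous (Th M) \<tau>"
    unfolding pw_continuous_def
  proof
    fix K assume K: "K \<in> Th M"
    show "\<exists>p. continuous_on UNIV p \<and> (\<forall>x\<in>interior K. \<tau> x = p x)"
    proof (cases "K \<in> patch M z")
      case True then show ?thesis using p unfolding pw_continuous_def by blast
    next
      case False
      then show ?thesis using zero[OF K] by (intro exI[of _ "\<lambda>x. 0"]) auto
    qed
  qed
  fix F x assume F: "F \<in> edges M" "z \<notin> F" and x: "x \<in> F"
  note Km = admissible_Km[OF M F(1)]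
  show "normal_tr M F \<tau> x = 0"
  proof (cases "Km M F \<in> patch M z")
    case True
    then have "F \<subseteq> frontier (omega M z)"
      using facet_opposite_frontier[OF T Km(1) _ Km(2) F(2)] unfolding omega_def patch_def by blast
    then show ?thesis
      using \<tau> F True Km(2) x unfolding RT_ring_patch0_def normal_tr_def by blast
  next
    case False
    have "tr (Km M F) \<tau> x = 0"
      by (rule tr_tendsto[OF Km(4), of _ "\<lambda>x. 0"]) (use zero[OF Km(1) False] x Km(3) in auto)
    then show ?thesis unfolding normal_tr_def by simp
  qed
qed

text \<open>Supported on the open triangles only, which makes measurability immediate even though nothing
  is known about the values of \<open>v\<close> on the edges.\<close>

definition patch_restrict :: "fe_mesh \<Rightarrow> real^2 \<Rightarrow> (real^2 \<Rightarrow> real) \<Rightarrow> real^2 \<Rightarrow> real" where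
  "patch_restrict M z v x = (if x \<in> (\<Union>K\<in>patch M z. interior K) then v x else 0)"

lemma patch_restrict_interior:
  assumes "triangles (Th M)" "K \<in> Th M" "x \<in> interior K"
  shows "patch_restrict M z v x = (if K \<in> patch M z then v x else 0)"
proof -
  have "K \<in> patch M z" if "x \<in> interior K'" "K' \<in> patch M z" for K'
    using omega_interior[OF assms] that interior_subset unfolding omega_def by blast
  then show ?thesis using assms(3) unfolding patch_restrict_def by auto
qed

lemma pw_continuous_patch_restrict:
  assumes T: "triangles (Th M)" and v: "pw_continuous (Th M) v"
  shows "pw_continuous (Th M) (patch_restrict M z v)"
  unfolding pw_continuous_def
proof
  fix K assume K: "K \<in> Th M"
  obtain p where p: "continuous_on UNIV p" "\<forall>x\<in>interior K. v x = p x"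
    using v K unfolding pw_continuous_def by blast
  show "\<exists>p. continuous_on UNIV p \<and> (\<forall>x\<in>interior K. patch_restrict M z v x = p x)"
    using p patch_restrict_interior[OF T K]
    by (intro exI[of _ "if K \<in> patch M z then p else (\<lambda>x. 0)"]) auto
qed

lemma compact_omega:
  assumes "triangles (Th M)"
  shows "compact (omega M z)"
  using triangles_finite[OF assms] triangles_simplex[OF assms] compact_simplex
  unfolding omega_def patch_def by (intro compact_Union) auto

text \<open>Square integrability is derived from piecewise continuity on the patch, which avoids
  comparing \<open>interior (omega M z)\<close> with \<open>Dom M\<close>.\<close>

lemma patch_restrict_DG_patch:
  assumes T: "triangles (Th M)" and v: "v \<in> DG M m"
  shows "patch_restrict M z v \<in> DG_patch M z m"
proof -
  have pT: "patch M z \<subseteq> Th M" unfolding patch_def by blast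
  have "pw_continuous (patch M z) (patch_restrict M z v)"
    using pw_continuous_mono[OF pw_continuous_patch_restrict[OF T] pT] v pw_continuous_DG_on unfolding DG_def by blast
  moreover have "interior (omega M z) \<in> lmeasurable"
    using compact_imp_bounded[OF compact_omega[OF T, of z]] interior_subset
    by (intro lmeasurable_open) (blast intro: bounded_subset, simp)
  moreover have "interior (omega M z) \<subseteq> \<Union>(patch M z)"
    using interior_subset unfolding omega_def .
  ultimately have "L2 (interior (omega M z)) (patch_restrict M z v)"
    by (intro pw_continuous_L2[OF triangles_subset[OF T pT]])
  moreover have "\<exists>p\<in>Pol m. \<forall>x\<in>interior K. patch_restrict M z v x = p x" if "K \<in> patch M z" for K
  proof -
    have "K \<in> Th M" using that pT by blast
    then obtain p where "p \<in> Pol m" "\<forall>x\<in>interior K. v x = p x"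
      using v unfolding DG_def DG_on_def by blast
    then show ?thesis
      using patch_restrict_interior[OF T \<open>K \<in> Th M\<close>] that by (intro bexI[of _ p]) auto
  qed
  moreover have "patch_restrict M z v x = 0" if "x \<notin> omega M z" for x
    using that interior_subset unfolding patch_restrict_def omega_def by auto
  ultimately show ?thesis unfolding DG_patch_def DG_on_def by blast
qed

text \<open>Edges without \<open>z\<close> drop out by the vanishing normal traces. The triangles
  adjacent to an edge through \<open>z\<close> are all in the patch, so restriction changes no trace
  there.\<close>

lemma jump_form_patch:
  assumes M: "admissible_mesh M" and z: "z \<in> vertices M" and \<tau>: "patch_flux M z \<tau>"
  shows "jump_form M (edges M - N_edges M) \<tau> v = local_form M z \<tau> (patch_restrict M z v)"
proof -
  note T = admissible_triangles[OF M]
  obtain K0 where K0: "K0 \<in> Th M" "z extreme_point_of K0" using z unfolding vertices_def by blast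
  have tr: "tr K v x = tr K (patch_restrict M z v) x" if "K \<in> Th M" "z \<in> K" for K x
  proof (rule tr_cong)
    have "K \<in> patch M z"
      using triangles_vertex[OF T that(1) K0 that(2)] that(1) unfolding patch_def by blast
    then show "v y = patch_restrict M z v y" if "y \<in> interior K" for y
      using patch_restrict_interior[OF T \<open>K \<in> Th M\<close> that] by simp
  qed
  have "jump_form M (edges M - N_edges M) \<tau> v = jump_form M (edges_at M z - N_edges M) \<tau> v"
    unfolding jump_form_def
  proof (rule sum.mono_neutral_right)
    show "finite (edges M - N_edges M)" using finite_edges[OF T] by blast
    show "edges_at M z - N_edges M \<subseteq> edges M - N_edges M" unfolding edges_at_def by blast
    show "\<forall>F\<in>edges M - N_edges M - (edges_at M z - N_edges M).
        edge_integral F (\<lambda>x. normal_tr M F \<tau> x * jump M F v x) = 0"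
    proof
      fix F assume "F \<in> edges M - N_edges M - (edges_at M z - N_edges M)"
      then have F: "F \<in> edges M" "z \<notin> F" unfolding edges_at_def by auto
      note Km = admissible_Km[OF M F(1)]
      have "edge_integral F (\<lambda>x. normal_tr M F \<tau> x * jump M F v x) = edge_integral F (\<lambda>x. 0)"
        by (rule edge_integral_cong[OF Km(4,2)]) (use \<tau> F in \<open>simp add: patch_flux_def\<close>)
      then show "edge_integral F (\<lambda>x. normal_tr M F \<tau> x * jump M F v x) = 0"
        by (simp add: edge_integral_zero)
    qed
  qed
  also have "\<dots> = local_form M z \<tau> (patch_restrict M z v)"
    unfolding local_form_def jump_form_def
  proof (rule sum.cong[OF refl])
    fix F assume "F \<in> edges_at M z - N_edges M"
    then have F: "F \<in> edges M" "z \<in> F" unfolding edges_at_def by auto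
    have "jump M F v x = jump M F (patch_restrict M z v) x" for x
      using tr admissible_Km(1,3)[OF M F(1)] admissible_Kp[OF M, of F] F(2)
      unfolding jump_def by (auto simp: subset_iff)
    then show "edge_integral F (\<lambda>x. normal_tr M F \<tau> x * jump M F v x)
        = edge_integral F (\<lambda>x. normal_tr M F \<tau> x * jump M F (patch_restrict M z v) x)"
      by simp
  qed
  finally show ?thesis .
qed

section \<open>Partition of unity and splitting of the residual\<close>

lemma pw_continuous_hat_function:
  assumes "hat_function M z l"
  shows "pw_continuous (Th M) l"
  unfolding pw_continuous_def
proof
  fix K assume "K \<in> Th M"
  then obtain a b where ab: "\<forall>x\<in>K. l x = a + b \<bullet> x"
    using assms unfolding hat_function_def by blast
  show "\<exists>p. continuous_on UNIV p \<and> (\<forall>x\<in>interior K. l x = p x)"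
    using ab interior_subset[of K]
    by (intro exI[of _ "\<lambda>x. a + b \<bullet> x"] conjI continuous_intros) blast
qed

text \<open>On a triangle where restriction has removed \<open>v\<close>, the hat function vanishes
  anyway, being affine there and zero at all its vertices. So the plain partition of unity
  survives.\<close>

lemma hat_functions_partition:
  assumes T: "triangles (Th M)" and hat: "\<And>z. z \<in> vertices M \<Longrightarrow> hat_function M z (l z)"
    and K: "K \<in> Th M" and x: "x \<in> interior K"
  shows "(\<Sum>z\<in>vertices M. patch_restrict M z v x * l z x) = v x"
proof -
  have xK: "x \<in> K" using x interior_subset by blast
  note sK = triangles_simplex[OF T K]
  have aff: "\<exists>a b. \<forall>x\<in>K. l z x = a + b \<bullet> x" if "z \<in> vertices M" for z
    using hat[OF that] K unfolding hat_function_def by blast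
  have val: "l z y = (if y = z then 1 else 0)" if "z \<in> vertices M" "y extreme_point_of K" for z y
    using hat[OF that(1)] that(2) K unfolding hat_function_def vertices_def by blast
  have "(\<Sum>z\<in>vertices M. l z x) = 1"
  proof (rule affine_partition_of_unity[OF sK finite_vertices[OF T] aff _ xK])
    fix y assume y: "y extreme_point_of K"
    then have "y \<in> vertices M" using K unfolding vertices_def by blast
    moreover have "(\<Sum>z\<in>vertices M. l z y) = (\<Sum>z\<in>vertices M. if y = z then 1 else 0)"
      by (rule sum.cong) (auto simp: val y)
    ultimately show "(\<Sum>z\<in>vertices M. l z y) = 1" using finite_vertices[OF T] by simp
  qed
  moreover have "patch_restrict M z v x * l z x = v x * l z x" if z: "z \<in> vertices M" for z
  proof (cases "K \<in> patch M z")
    case True then show ?thesis using patch_restrict_interior[OF T K x] by simp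
  next
    case False
    then have nz: "\<not> z extreme_point_of K" using K unfolding patch_def by blast
    \<comment> \<open>The affine lemma for the single function \<open>l z\<close> with the constant
      0, as \<open>z\<close> is no vertex of \<open>K\<close>.\<close>
    have "(\<Sum>w\<in>{z}. l w x) = 0"
      by (rule affine_partition_of_unity[OF sK _ _ _ xK]) (use aff[OF z] val[OF z] nz in auto)
    then show ?thesis by simp
  qed
  then have "(\<Sum>z\<in>vertices M. patch_restrict M z v x * l z x) = v x * (\<Sum>z\<in>vertices M. l z x)"
    unfolding sum_distrib_left by (rule sum.cong[OF refl])
  ultimately show ?thesis by simp
qed

text \<open>The pointwise identity holds inside the triangles, hence almost everywhere. Sum and
  integral may be exchanged because the \<open>L2\<close> factor times a piecewise continuous field
  is integrable.\<close>

lemma residual_partition: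
  assumes M: "admissible_mesh M" and f: "L2 (Dom M) f" and \<sigma>: "\<sigma> \<in> RT M m"
    and hat: "\<And>z. z \<in> vertices M \<Longrightarrow> hat_function M z (l z)" and v: "v \<in> DG M s"
  shows "(\<Sum>z\<in>vertices M. residual M f \<sigma> (\<lambda>x. patch_restrict M z v x * l z x)) = residual M f \<sigma> v"
proof -
  note T = admissible_triangles[OF M]
  note D = admissible_dom[OF M]
  have "\<exists>d. has_weak_div (Dom M) \<sigma> d"
    using \<sigma> unfolding RT_def RT_on_def Hdiv_def by blast
  \<comment> \<open>\<open>weak_div\<close> is a \<open>SOME\<close>; membership in
    \<open>RT\<close> supplies the existence that makes it square integrable.\<close>
  then have "has_weak_div (Dom M) \<sigma> (weak_div (Dom M) \<sigma>)"
    unfolding weak_div_def by (rule someI_ex)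
  then have d: "L2 (Dom M) (weak_div (Dom M) \<sigma>)" unfolding has_weak_div_def by blast
  define h where "h x = f x - weak_div (Dom M) \<sigma> x" for x
  have int: "integrable (lebesgue_on (Dom M)) (\<lambda>x. h x * w x)" if "pw_continuous (Th M) w" for w
  proof -
    have "L2 (Dom M) w" using pw_continuous_L2[OF T that D] .
    then show ?thesis
      unfolding h_def left_diff_distrib
      using L2_product_integrable f d by (intro Bochner_Integration.integrable_diff) blast+
  qed
  have pv: "pw_continuous (Th M) v" using v pw_continuous_DG_on unfolding DG_def by blast
  have pl: "pw_continuous (Th M) (\<lambda>x. patch_restrict M z v x * l z x)" if "z \<in> vertices M" for z
    by (intro pw_continuous_mult pw_continuous_patch_restrict T pv pw_continuous_hat_function[OF hat[OF that]])
  have "(\<Sum>z\<in>vertices M. residual M f \<sigma> (\<lambda>x. patch_restrict M z v x * l z x))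
      = integral\<^sup>L (lebesgue_on (Dom M)) (\<lambda>x. \<Sum>z\<in>vertices M. h x * (patch_restrict M z v x * l z x))"
    unfolding residual_def L2_inner_def inner_real_def h_def[symmetric]
    using int pl by (intro Bochner_Integration.integral_sum[symmetric]) blast
  also have "\<dots> = integral\<^sup>L (lebesgue_on (Dom M)) (\<lambda>x. h x * v x)"
  proof (rule integral_cong_AE)
    show "(\<lambda>x. \<Sum>z\<in>vertices M. h x * (patch_restrict M z v x * l z x))
        \<in> borel_measurable (lebesgue_on (Dom M))"
      using int pl by (intro borel_measurable_sum borel_measurable_integrable) blast
    show "(\<lambda>x. h x * v x) \<in> borel_measurable (lebesgue_on (Dom M))"
      using int pv by (intro borel_measurable_integrable) blast
    have "Dom M \<in> sets lebesgue" using D by blast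
    from AE_triangles_interior(2)[OF T this D(2)]
    show "AE x in lebesgue_on (Dom M).
        (\<Sum>z\<in>vertices M. h x * (patch_restrict M z v x * l z x)) = h x * v x"
    proof eventually_elim
      case (elim x)
      then show ?case
        using hat_functions_partition[where l=l and v=v, OF T hat] by (auto simp flip: sum_distrib_left)
    qed
  qed
  finally show ?thesis
    unfolding residual_def L2_inner_def inner_real_def h_def .
qed

section \<open>The minimizing coefficient\<close>

text \<open>An explicit root: with \<open>d = sqrt (det C)\<close>, Cayley-Hamilton gives
  \<open>(C + d I)^2 = (trace C + 2 d) C\<close>, so \<open>C + d I\<close> divided by
  \<open>sqrt (trace C + 2 d)\<close> squares to \<open>C\<close>.\<close>

lemma spd_sqrt_exists:
  assumes C: "spd C"
  shows "\<exists>S. spd S \<and> S ** S = C"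
proof -
  define p q r where "p = C $ 1 $ 1" and "q = C $ 1 $ 2" and "r = C $ 2 $ 2"
  have "transpose C = C" using C unfolding spd_def by blast
  moreover have "C $ 2 $ 1 = transpose C $ 1 $ 2" unfolding transpose_def by simp
  ultimately have "C $ 2 $ 1 = q" unfolding q_def by simp
  then have C_entries: "C $ 1 $ 1 = p" "C $ 1 $ 2 = q" "C $ 2 $ 1 = q" "C $ 2 $ 2 = r"
    unfolding p_def q_def r_def by simp_all
  have form: "\<xi> \<bullet> (C *v \<xi>) = p * (\<xi>$1)\<^sup>2 + 2 * q * \<xi>$1 * \<xi>$2 + r * (\<xi>$2)\<^sup>2" for \<xi>
    by (simp add: inner_vec_def matrix_vector_mult_def sum_2 C_entries power2_eq_square algebra_simps)
  have p: "0 < p"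
  proof -
    define \<xi> :: "real^2" where "\<xi> = vector [1, 0]"
    have "\<xi> \<noteq> 0" unfolding \<xi>_def by (auto simp: vec_eq_iff forall_2)
    then have "0 < \<xi> \<bullet> (C *v \<xi>)" using C unfolding spd_def by blast
    then show ?thesis unfolding form \<xi>_def by simp
  qed
  have "0 < p * (p * r - q\<^sup>2)"
  proof -
    \<comment> \<open>This vector turns the quadratic form into \<open>p\<close> times the
      determinant.\<close>
    define \<xi> :: "real^2" where "\<xi> = vector [q, - p]"
    have "\<xi> \<noteq> 0" using p unfolding \<xi>_def by (auto simp: vec_eq_iff forall_2)
    then have "0 < \<xi> \<bullet> (C *v \<xi>)" using C unfolding spd_def by blast
    then show ?thesis unfolding form \<xi>_def by (simp add: power2_eq_square algebra_simps)
  qed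
  then have det: "0 < p * r - q\<^sup>2" using p by (simp add: zero_less_mult_iff)
  then have r: "0 < r" using p by (smt (verit) mult_nonneg_nonpos zero_le_power2)
  \<comment> \<open>These are the determinant and the trace of the root to be constructed.\<close>
  define \<delta> \<tau> where "\<delta> = sqrt (p * r - q\<^sup>2)" and "\<tau> = sqrt (p + r + 2 * \<delta>)"
  have \<delta>: "0 < \<delta>" "\<delta> * \<delta> = p * r - q\<^sup>2" unfolding \<delta>_def using det by simp_all
  have \<tau>: "0 < \<tau>" "\<tau> * \<tau> = p + r + 2 * \<delta>" unfolding \<tau>_def using p r \<delta> by simp_all
  define S where "S = (1 / \<tau>) *\<^sub>R (C + \<delta> *\<^sub>R mat 1)"
  have "spd S"
    unfolding spd_def
  proof (intro conjI allI impI)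
    show "transpose S = S"
      by (simp add: S_def transpose_def vec_eq_iff forall_2 mat_def C_entries)
    fix \<xi> :: "real^2" assume "\<xi> \<noteq> 0"
    then have "0 < \<xi> \<bullet> (C *v \<xi>)" "0 < \<xi> \<bullet> \<xi>" using C unfolding spd_def by auto
    moreover have "\<xi> \<bullet> (S *v \<xi>) = (\<xi> \<bullet> (C *v \<xi>) + \<delta> * (\<xi> \<bullet> \<xi>)) / \<tau>"
      unfolding S_def
      by (simp add: matrix_vector_mult_add_rdistrib inner_add_right flip: scaleR_matrix_vector_assoc)
    ultimately show "0 < \<xi> \<bullet> (S *v \<xi>)" using \<tau>(1) \<delta>(1) by (simp add: add_pos_pos)
  qed
  moreover have "S ** S = C"
  proof -
    have S: "S $ 1 $ 1 = (p + \<delta>) / \<tau>" "S $ 1 $ 2 = q / \<tau>" "S $ 2 $ 1 = q / \<tau>" "S $ 2 $ 2 = (r + \<delta>) / \<tau>"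
      by (simp_all add: S_def mat_def C_entries)
    have *: "a / \<tau> * (b / \<tau>) + c / \<tau> * (d / \<tau>) = e" if "a * b + c * d = e * (\<tau> * \<tau>)" for a b c d e
      using \<tau>(1) that by (simp add: field_simps)
    have "(S ** S) $ 1 $ 1 = p" "(S ** S) $ 1 $ 2 = q" "(S ** S) $ 2 $ 1 = q" "(S ** S) $ 2 $ 2 = r"
      unfolding matrix_matrix_mult_def vec_lambda_beta sum_2 S
      by (rule *; use \<delta>(2) in \<open>simp add: \<tau>(2) power2_eq_square algebra_simps\<close>)+
    then show ?thesis by (simp add: vec_eq_iff forall_2 C_entries)
  qed
  ultimately show ?thesis by blast
qed

text \<open>Injectivity gives a two-sided inverse, symmetry follows from its uniqueness, and
  positivity from writing the vector as an image under \<open>B\<close>.\<close>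

lemma spd_matrix_inv:
  assumes B: "spd B"
  shows "spd (matrix_inv B)"
proof -
  have "inj ((*v) B)"
  proof (rule injI)
    fix x y assume "B *v x = B *v y"
    then have "(x - y) \<bullet> (B *v (x - y)) = 0" by (simp add: matrix_vector_mult_diff_distrib)
    then show "x = y" using B unfolding spd_def by (metis less_irrefl right_minus_eq)
  qed
  then have "invertible B" using matrix_left_invertible_injective invertible_left_inverse by blast
  then have i: "B ** matrix_inv B = mat 1" "matrix_inv B ** B = mat 1"
    using someI_ex[of "\<lambda>A'. B ** A' = mat 1 \<and> A' ** B = mat 1"]
    unfolding invertible_def matrix_inv_def by blast+
  have tB: "transpose B = B" using B unfolding spd_def by blast
  have "transpose (matrix_inv B) ** B = mat 1"
    using arg_cong[OF i(1), of transpose] by (simp add: matrix_transpose_mul tB transpose_mat)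
  then have "transpose (matrix_inv B) = matrix_inv B"
    using i by (metis matrix_mul_assoc matrix_mul_lid matrix_mul_rid)
  moreover have "0 < \<xi> \<bullet> (matrix_inv B *v \<xi>)" if "\<xi> \<noteq> 0" for \<xi>
  proof -
    define \<eta> where "\<eta> = matrix_inv B *v \<xi>"
    have \<xi>: "\<xi> = B *v \<eta>" unfolding \<eta>_def by (simp add: matrix_vector_mul_assoc i)
    then have "\<eta> \<noteq> 0" using that by auto
    then show ?thesis using B \<xi> unfolding spd_def \<eta>_def[symmetric] by (metis inner_commute)
  qed
  ultimately show ?thesis unfolding spd_def by blast
qed

text \<open>Existence of a root gives meaning to the \<open>SOME\<close> in \<open>inv_sqrt\<close>.
  Symmetry then lets one factor cross the inner product and square with the other.\<close>

lemma inv_sqrt_inner: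
  assumes "spd B"
  shows "(inv_sqrt B *v x) \<bullet> (inv_sqrt B *v y) = (matrix_inv B *v x) \<bullet> y"
proof -
  have "spd (inv_sqrt B) \<and> inv_sqrt B ** inv_sqrt B = matrix_inv B"
    unfolding inv_sqrt_def by (rule someI_ex) (rule spd_sqrt_exists[OF spd_matrix_inv[OF assms]])
  then have S: "transpose (inv_sqrt B) = inv_sqrt B" "inv_sqrt B ** inv_sqrt B = matrix_inv B"
    unfolding spd_def by blast+
  have "(inv_sqrt B *v x) \<bullet> (inv_sqrt B *v y) = (transpose (inv_sqrt B) *v (inv_sqrt B *v x)) \<bullet> y"
    by (simp add: transpose_matrix_vector dot_lmul_matrix)
  then show ?thesis by (simp add: S matrix_vector_mul_assoc)
qed

text \<open>\<open>h\<close> is arbitrary because \<open>h (A x)\<close> is constant inside each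
  triangle; the instances are \<open>inv_sqrt\<close> and \<open>matrix_inv\<close>.\<close>

lemma pw_continuous_tensor:
  assumes A: "pw_const_spd M A" and \<tau>: "pw_continuous (Th M) \<tau>"
  shows "pw_continuous (Th M) (\<lambda>x. (h (A x) :: real^2^2) *v \<tau> x)"
  unfolding pw_continuous_def
proof
  fix K assume K: "K \<in> Th M"
  obtain B where B: "\<forall>x\<in>interior K. A x = B" using A K unfolding pw_const_spd_def by blast
  obtain p where p: "continuous_on UNIV p" "\<forall>x\<in>interior K. \<tau> x = p x"
    using \<tau> K unfolding pw_continuous_def by blast
  have "continuous_on UNIV (\<lambda>x. h B *v p x)"
    using p(1) by (rule bounded_linear.continuous_on[OF matrix_vector_mul_bounded_linear])
  then show "\<exists>p. continuous_on UNIV p \<and> (\<forall>x\<in>interior K. h (A x) *v \<tau> x = p x)"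
    using B p(2) by (intro exI[of _ "\<lambda>x. h B *v p x"]) auto
qed

section \<open>Minimization along the kernel field\<close>

text \<open>Completing the square shows that the minimizer is unique, which determines the choice
  made by \<open>ARG_MIN\<close>. As \<open>sqrt\<close> increases strictly on the whole real line,
  the sign of the radicand does not matter.\<close>

lemma arg_min_sqrt_quadratic:
  fixes f :: "real \<Rightarrow> real"
  assumes f: "\<And>l. f l = sqrt (a - 2 * l * b + l\<^sup>2)"
  shows "(ARG_MIN f l. True) = b"
proof -
  have q: "a - 2 * l * b + l\<^sup>2 = (a - b\<^sup>2) + (l - b)\<^sup>2" for l
    by (simp add: power2_eq_square algebra_simps)
  show ?thesis
  proof (rule arg_minI[of "\<lambda>l. True" b f "\<lambda>l. l = b"])
    show "\<not> f y < f b" for y unfolding f q by simp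
    fix x assume "\<forall>y. True \<longrightarrow> \<not> f y < f x"
    then have "\<not> f b < f x" by blast
    then show "x = b" unfolding f q by simp
  qed simp
qed

lemma minimized_eq:
  assumes T: "triangles (Th M)" and A: "pw_const_spd M A"
    and \<sigma>: "pw_continuous (Th M) \<sigma>" "pw_continuous (Th M) \<sigma>'" and norm: "weighted_norm M A z \<sigma>' = 1"
  shows "minimized M A z \<sigma> \<sigma>' = (\<lambda>x. \<sigma> x - coeff_c M A z \<sigma> \<sigma>' *\<^sub>R \<sigma>' x)"
proof -
  define \<rho> \<rho>' where "\<rho> x = inv_sqrt (A x) *v \<sigma> x" and "\<rho>' x = inv_sqrt (A x) *v \<sigma>' x" for x
  have \<rho>: "pw_continuous (Th M) \<rho>" "pw_continuous (Th M) \<rho>'"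
    unfolding \<rho>_def \<rho>'_def using pw_continuous_tensor[OF A] \<sigma> by blast+
  have \<omega>: "omega M z \<in> lmeasurable" "omega M z \<subseteq> \<Union>(Th M)"
    using lmeasurable_compact[OF compact_omega[OF T]] unfolding omega_def patch_def by auto
  have int: "integrable (lebesgue_on (omega M z)) (\<lambda>x. v x \<bullet> w x)"
    if "pw_continuous (Th M) v" "pw_continuous (Th M) w" for v w :: "real^2 \<Rightarrow> real^2"
    by (rule pw_continuous_integrable[OF T pw_continuous_inner[OF that] \<omega>])
  have one: "L2_inner (omega M z) \<rho>' \<rho>' = 1"
    using norm unfolding weighted_norm_def L2_norm_def \<rho>'_def by simp
  \<comment> \<open>\<open>A x\<close> is known to be positive definite only inside the triangles,
    so the integrands are compared there.\<close>
  have b: "L2_inner (omega M z) \<rho> \<rho>' = coeff_c M A z \<sigma> \<sigma>'"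
    unfolding coeff_c_def L2_inner_def
  proof (rule pw_continuous_integral_cong[OF T _ _ \<omega>])
    show "pw_continuous (Th M) (\<lambda>x. \<rho> x \<bullet> \<rho>' x)" "pw_continuous (Th M) (\<lambda>x. (matrix_inv (A x) *v \<sigma> x) \<bullet> \<sigma>' x)"
      by (intro pw_continuous_inner \<rho> \<sigma> pw_continuous_tensor[OF A])+
    fix K x assume "K \<in> Th M" "x \<in> interior K"
    then have "spd (A x)" using A unfolding pw_const_spd_def by auto
    then show "\<rho> x \<bullet> \<rho>' x = (matrix_inv (A x) *v \<sigma> x) \<bullet> \<sigma>' x"
      unfolding \<rho>_def \<rho>'_def by (rule inv_sqrt_inner)
  qed
  have "weighted_norm M A z (\<lambda>x. \<sigma> x - l *\<^sub>R \<sigma>' x)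
      = sqrt (L2_inner (omega M z) \<rho> \<rho> - 2 * l * coeff_c M A z \<sigma> \<sigma>' + l\<^sup>2)" for l
  proof -
    have "L2_inner (omega M z) (\<lambda>x. inv_sqrt (A x) *v (\<sigma> x - l *\<^sub>R \<sigma>' x))
         (\<lambda>x. inv_sqrt (A x) *v (\<sigma> x - l *\<^sub>R \<sigma>' x))
       = integral\<^sup>L (lebesgue_on (omega M z))
           (\<lambda>x. \<rho> x \<bullet> \<rho> x - 2 * l * (\<rho> x \<bullet> \<rho>' x) + l\<^sup>2 * (\<rho>' x \<bullet> \<rho>' x))"
      unfolding L2_inner_def \<rho>_def \<rho>'_def
      by (rule Bochner_Integration.integral_cong[OF refl])
        (simp add: matrix_vector_mult_diff_distrib matrix_vector_mult_scaleR inner_diff_left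
          inner_diff_right inner_commute power2_eq_square algebra_simps)
    also have "\<dots> = L2_inner (omega M z) \<rho> \<rho> - 2 * l * L2_inner (omega M z) \<rho> \<rho>'
         + l\<^sup>2 * L2_inner (omega M z) \<rho>' \<rho>'"
      unfolding L2_inner_def using int \<rho> by simp
    finally show ?thesis
      unfolding weighted_norm_def L2_norm_def by (simp add: one b)
  qed
  then have "(ARG_MIN (\<lambda>l. weighted_norm M A z (\<lambda>x. \<sigma> x - l *\<^sub>R \<sigma>' x)) l. True) = coeff_c M A z \<sigma> \<sigma>'"
    by (rule arg_min_sqrt_quadratic)
  then show ?thesis unfolding minimized_def by simp
qed

section \<open>The global correction\<close>

theorem theorem5p9:
  fixes M :: fe_mesh
    and A :: "real^2 \<Rightarrow> real^2^2"
    and f g u :: "real^2 \<Rightarrow> real"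
    and k s :: nat
    and \<sigma>t :: "real^2 \<Rightarrow> real^2"
    and lam :: "real^2 \<Rightarrow> real^2 \<Rightarrow> real"
    and \<sigma>delta \<sigma>sharp :: "real^2 \<Rightarrow> real^2 \<Rightarrow> real^2"
  assumes mesh: "admissible_mesh M"
    and tensor: "pw_const_spd M A"
    and source: "L2 (Dom M) f"
    and k: "1 \<le> k" and s: "s \<le> k - 1"
    and neumann: "neumann_data M (k - 1) g"
    and hat: "\<And>z. z \<in> vertices M \<Longrightarrow> hat_function M z (lam z)"
    and solution: "cg_solution M A f g k u"
    and flux: "averaging_flux M A g (k - 1) u \<sigma>t"
    and delta_space: "\<And>z. z \<in> vertices M \<Longrightarrow> \<sigma>delta z \<in> RT_ring_patch0 M z s"
    and delta_eq: "\<And>z v. z \<in> vertices M \<Longrightarrow> v \<in> DG_patch M z s \<Longrightarrow>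
          local_form M z (\<sigma>delta z) v = residual M f \<sigma>t (\<lambda>x. v x * lam z x)"
    and kernel_space: "\<And>z. z \<in> vertices_star M \<Longrightarrow> \<sigma>sharp z \<in> RT_ring_patch0 M z s"
    and kernel_eq: "\<And>z v. z \<in> vertices_star M \<Longrightarrow> v \<in> DG_patch M z s \<Longrightarrow>
          local_form M z (\<sigma>sharp z) v = 0"
    and kernel_norm: "\<And>z. z \<in> vertices_star M \<Longrightarrow> weighted_norm M A z (\<sigma>sharp z) = 1"
  shows "(\<forall>v\<in>DG M s.
            jump_form M (edges M - N_edges M) (global_correction M A \<sigma>delta \<sigma>sharp) v = residual M f \<sigma>t v) \<and>
         global_correction M A \<sigma>delta \<sigma>sharp =
           (\<lambda>x. (\<Sum>z\<in>vertices_star M. \<sigma>delta z x - coeff_c M A z (\<sigma>delta z) (\<sigma>sharp z) *\<^sub>R \<sigma>sharp z x) +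
                (\<Sum>z\<in>vertices M - vertices_star M. \<sigma>delta z x))"
proof -
  note T = admissible_triangles[OF mesh]
  have star: "vertices_star M \<subseteq> vertices M" unfolding vertices_star_def by blast
  define c where "c z = coeff_c M A z (\<sigma>delta z) (\<sigma>sharp z)" for z
  have pd: "patch_flux M z (\<sigma>delta z)" if "z \<in> vertices M" for z
    using RT_ring_patch0_patch_flux[OF mesh delta_space[OF that]] .
  have ps: "patch_flux M z (\<sigma>sharp z)" if "z \<in> vertices_star M" for z
    using RT_ring_patch0_patch_flux[OF mesh kernel_space[OF that]] .
  have cd: "pw_continuous (Th M) (\<sigma>delta z)" if "z \<in> vertices M" for z
    using pd[OF that] unfolding patch_flux_def by blast
  have cs: "pw_continuous (Th M) (\<sigma>sharp z)" if "z \<in> vertices_star M" for z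
    using ps[OF that] unfolding patch_flux_def by blast
  have min: "minimized M A z (\<sigma>delta z) (\<sigma>sharp z) = (\<lambda>x. \<sigma>delta z x - c z *\<^sub>R \<sigma>sharp z x)"
    if "z \<in> vertices_star M" for z
    unfolding c_def using that star
    by (intro minimized_eq[OF T tensor cd cs kernel_norm]) auto
  have gc: "global_correction M A \<sigma>delta \<sigma>sharp =
      (\<lambda>x. (\<Sum>z\<in>vertices_star M. \<sigma>delta z x - c z *\<^sub>R \<sigma>sharp z x) +
           (\<Sum>z\<in>vertices M - vertices_star M. \<sigma>delta z x))"
    unfolding global_correction_def fun_eq_iff using min by simp
  \<comment> \<open>One summand per vertex, in the shape of \<open>jump_form_add_scale\<close>. Off
    \<open>vertices_star M\<close> nothing is known about \<open>\<sigma>sharp z\<close>, so zero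
    takes its place.\<close>
  define \<tau> where "\<tau> z x = \<sigma>delta z x + (if z \<in> vertices_star M then - c z else 0) *\<^sub>R
      (if z \<in> vertices_star M then \<sigma>sharp z x else 0)" for z x
  have gc': "global_correction M A \<sigma>delta \<sigma>sharp = (\<lambda>x. \<Sum>z\<in>vertices M. \<tau> z x)"
    unfolding gc sum.subset_diff[OF star finite_vertices[OF T]] \<tau>_def by (simp add: add.commute)
  have "jump_form M (edges M - N_edges M) (global_correction M A \<sigma>delta \<sigma>sharp) v = residual M f \<sigma>t v"
    if v: "v \<in> DG M s" for v
  proof -
    have pv: "pw_continuous (Th M) v" using v pw_continuous_DG_on unfolding DG_def by blast
    note Es = Diff_subset[of "edges M" "N_edges M"]
    have \<sigma>t: "\<sigma>t \<in> RT M (k - 1)" using flux unfolding averaging_flux_def by blast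
    have c\<tau>: "pw_continuous (Th M) (\<tau> z)" if "z \<in> vertices M" for z
    proof (cases "z \<in> vertices_star M")
      case True
      then show ?thesis
        using pw_continuous_add[OF cd[OF that] pw_continuous_scaleR[OF cs[OF True]], of "- c z"] unfolding \<tau>_def by simp
    next
      case False
      then show ?thesis using cd[OF that] unfolding \<tau>_def by simp
    qed
    have j: "jump_form M (edges M - N_edges M) (\<tau> z) v =
        residual M f \<sigma>t (\<lambda>x. patch_restrict M z v x * lam z x)" if z: "z \<in> vertices M" for z
    proof -
      \<comment> \<open>The restricted \<open>v\<close> is an admissible test function for the local
        equation and for the kernel equation at once.\<close>
      note vz = patch_restrict_DG_patch[OF T v, of z]
      have d: "jump_form M (edges M - N_edges M) (\<sigma>delta z) v =
          residual M f \<sigma>t (\<lambda>x. patch_restrict M z v x * lam z x)"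
        using jump_form_patch[OF mesh z pd[OF z]] delta_eq[OF z vz] by simp
      show ?thesis
      proof (cases "z \<in> vertices_star M")
        case True
        have "jump_form M (edges M - N_edges M) (\<sigma>sharp z) v = 0"
          using jump_form_patch[OF mesh z ps[OF True]] kernel_eq[OF True vz] by simp
        then show ?thesis
          using jump_form_add_scale[OF mesh cd[OF z] cs[OF True] pv Es, of "- c z"] d True
          unfolding \<tau>_def by simp
      next
        case False
        then show ?thesis using d unfolding \<tau>_def by simp
      qed
    qed
    have "jump_form M (edges M - N_edges M) (global_correction M A \<sigma>delta \<sigma>sharp) v
        = (\<Sum>z\<in>vertices M. jump_form M (edges M - N_edges M) (\<tau> z) v)"
      unfolding gc' by (rule jump_form_sum[OF mesh c\<tau> pv Es])
    also have "\<dots> = (\<Sum>z\<in>vertices M. residual M f \<sigma>t (\<lambda>x. patch_restrict M z v x * lam z x))"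
      by (rule sum.cong[OF refl j])
    also have "\<dots> = residual M f \<sigma>t v"
      by (rule residual_partition[OF mesh source \<sigma>t hat v])
    finally show ?thesis .
  qed
  then show ?thesis using gc unfolding c_def by blast
qed

end
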